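(* Let $(W_1,S_1)$, $(W_2,S_2)$ be Coxeter systems of finite rank with sets of reflections $T_1,T_2$, let $S_1=\{s_1,\dots,s_k\}$, $S_2=\{s_{k+1},\dots,s_n\}$, $h_1=s_1\cdots s_k$, $h_2=s_{k+1}\cdots s_n$. Assume that $(W_1,(s_1,\dots,s_k))$ and $(W_2,(s_{k+1},\dots,s_n))$ are well-stabilized and that $(W_1,T_1,h_1)$ and $(W_2,T_2,h_2)$ are pan-transitive. Define $W_\times=W_1\times W_2$, $S_\times=S_1\times\{1\}\cup\{1\}\times S_2$ and $T_\times=T_1\times\{1\}\cup\{1\}\times T_2$. Then $(W_\times,((s_1,1),\dots,(s_k,1),(1,s_{k+1}),\dots,(1,s_n)))$ is well-stabilized and $(W_\times,T_\times,(h_1,h_2))$ is pan-transitive. In particular, $\mathrm{Art}(W_\times,S_\times)$ is isomorphic to $\mathrm{Art}^*(W_\times,T_\times,(h_1,h_2))$.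
   Context: A Coxeter system $(W,S)$: $W=\langle S\mid (ss')^{m(s,s')}=1\text{ whenever } m(s,s')\neq\infty\rangle$ with $m$ symmetric, $m(s,s)=1$, $m(s,s')\in\{2,3,\dots,\infty\}$ for $s\neq s'$; reflections are conjugates of elements of $S$. $(W_\times,S_\times)$ is a Coxeter system (with $m=2$ between elements from different factors) whose set of reflections is $T_\times$. For a group $G$ with generating set $X$ and $a\in G$: $\ell_X(a)$ is the minimal $k$ with $a=x_1\cdots x_k$, $x_i\in X\cup X^{-1}$; $\mathrm{Red}_X(a)$ the set of such tuples of length $\ell_X(a)$; $a\le_X b$ iff $\ell_X(a)+\ell_X(a^{-1}b)=\ell_X(b)$; $[1,b]_X=\{a:a\le_Xb\}$. The braid group $B_m$ acts on $G^m$ by the Hurwitz action $\sigma_i\cdot(g_1,\dots,g_m)=(g_1,\dots,g_{i-1},g_ig_{i+1}g_i^{-1},g_i,g_{i+2},\dots,g_m)$. For a Coxeter system $(V,R)$ with ordering $(r_1,\dots,r_m)$ of $R$: $\mathrm{Art}(V,R)$ is generated by $\bar r_1,\dots,\bar r_m$ subject to $\bar r_i\bar r_j\bar r_i\cdots=\bar r_j\bar r_i\bar r_j\cdots$ (each side with $m(r_i,r_j)$ factors) whenever $m(r_i,r_j)\neq\infty$; $(V,(r_1,\dots,r_m))$ is well-stabilized if the stabilizer in $B_m$ of $(r_1,\dots,r_m)\in V^m$ equals the stabilizer of $(\bar r_1,\dots,\bar r_m)\in\mathrm{Art}(V,R)^m$ under the Hurwitz action. With reflections $T_V$ and Coxeter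 element $c$ (product of all elements of $R$ in some order), $\mathrm{Art}^*(V,T_V,c)$ is generated by symbols $\{t\}$, $t\in T_V\cap[1,c]_{T_V}$, subject to $\{t_1\}\cdots\{t_k\}=\{t'_1\}\cdots\{t'_k\}$ whenever both tuples lie in $\mathrm{Red}_{T_V}(a)$ for some $a\in[1,c]_{T_V}$; $(V,T_V,c)$ is pan-transitive if for each $a\in[1,c]_{T_V}$ the Hurwitz action of $B_{\ell_{T_V}(a)}$ on $\mathrm{Red}_{T_V}(a)$ is transitive. *)

theory Defs
  imports "HOL-Algebra.Algebra"
begin

text \<open>Words over a set Y of generators: letters (g, b) with g in Y; b = True marks
  the inverse letter g^-1.\<close>

definition pwords :: "'g set \<Rightarrow> ('g \<times> bool) list set" where
  "pwords Y = {w. \<forall>x\<in>set w. fst x \<in> Y}"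

inductive_set pres_eq :: "'g set \<Rightarrow> (('g \<times> bool) list \<times> ('g \<times> bool) list) set
    \<Rightarrow> (('g \<times> bool) list \<times> ('g \<times> bool) list) set"
  for Y R where
  refl: "w \<in> pwords Y \<Longrightarrow> (w, w) \<in> pres_eq Y R"
| sym: "(u, v) \<in> pres_eq Y R \<Longrightarrow> (v, u) \<in> pres_eq Y R"
| trans: "(u, v) \<in> pres_eq Y R \<Longrightarrow> (v, w) \<in> pres_eq Y R \<Longrightarrow> (u, w) \<in> pres_eq Y R"
| cancel: "u \<in> pwords Y \<Longrightarrow> v \<in> pwords Y \<Longrightarrow> g \<in> Y \<Longrightarrow>
     (u @ [(g, b), (g, \<not> b)] @ v, u @ v) \<in> pres_eq Y R"
| rel: "(l, r) \<in> R \<Longrightarrow> l \<in> pwords Y \<Longrightarrow> r \<in> pwords Y \<Longrightarrow> u \<in> pwords Y \<Longrightarrow>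
     v \<in> pwords Y \<Longrightarrow> (u @ l @ v, u @ r @ v) \<in> pres_eq Y R"

definition presented_group :: "'g set \<Rightarrow> (('g \<times> bool) list \<times> ('g \<times> bool) list) set
    \<Rightarrow> ('g \<times> bool) list set monoid" where
  "presented_group Y R =
     \<lparr>carrier = pwords Y // pres_eq Y R,
      monoid.mult = (\<lambda>A B. pres_eq Y R `` {(SOME a. a \<in> A) @ (SOME b. b \<in> B)}),
      one = pres_eq Y R `` {[]}\<rparr>"

definition pgen :: "'g set \<Rightarrow> (('g \<times> bool) list \<times> ('g \<times> bool) list) set
    \<Rightarrow> 'g \<Rightarrow> ('g \<times> bool) list set" where
  "pgen Y R g = pres_eq Y R `` {[(g, False)]}"

definition pos_word :: "'g list \<Rightarrow> ('g \<times> bool) list" where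
  "pos_word xs = map (\<lambda>x. (x, False)) xs"

text \<open>The braid group B_m on generators sigma_0, ..., sigma_(m-2) (0-based indices;
  sigma_i here is sigma_(i+1) of the paper).\<close>

definition braid_rels :: "nat \<Rightarrow> ((nat \<times> bool) list \<times> (nat \<times> bool) list) set" where
  "braid_rels m =
     {(pos_word [i, j], pos_word [j, i]) | i j. i < m - 1 \<and> j < m - 1 \<and> i + 2 \<le> j}
   \<union> {(pos_word [i, Suc i, i], pos_word [Suc i, i, Suc i]) | i. Suc i < m - 1}"

definition braid_group :: "nat \<Rightarrow> (nat \<times> bool) list set monoid" where
  "braid_group m = presented_group {i. i < m - 1} (braid_rels m)"

definition hurwitz_gen :: "('a, 'c) monoid_scheme \<Rightarrow> nat \<times> bool \<Rightarrow> 'a list \<Rightarrow> 'a list" where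
  "hurwitz_gen G ib xs = (let i = fst ib; a = xs ! i; b = xs ! Suc i in
     if \<not> snd ib
     then xs[i := a \<otimes>\<^bsub>G\<^esub> b \<otimes>\<^bsub>G\<^esub> inv\<^bsub>G\<^esub> a, Suc i := a]
     else xs[i := b, Suc i := inv\<^bsub>G\<^esub> b \<otimes>\<^bsub>G\<^esub> a \<otimes>\<^bsub>G\<^esub> b])"

definition hurwitz_word :: "('a, 'c) monoid_scheme \<Rightarrow> (nat \<times> bool) list \<Rightarrow> 'a list \<Rightarrow> 'a list" where
  "hurwitz_word G w xs = foldr (hurwitz_gen G) w xs"

definition hurwitz_act :: "('a, 'c) monoid_scheme \<Rightarrow> (nat \<times> bool) list set \<Rightarrow> 'a list \<Rightarrow> 'a list" where
  "hurwitz_act G \<beta> xs = hurwitz_word G (SOME w. w \<in> \<beta>) xs"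

definition hurwitz_stab :: "('a, 'c) monoid_scheme \<Rightarrow> 'a list \<Rightarrow> (nat \<times> bool) list set set" where
  "hurwitz_stab G xs = {\<beta> \<in> carrier (braid_group (length xs)). hurwitz_act G \<beta> xs = xs}"

text \<open>Coxeter matrices on S, with 0 encoding \<infinity>.\<close>

definition coxeter_matrix :: "'a set \<Rightarrow> ('a \<Rightarrow> 'a \<Rightarrow> nat) \<Rightarrow> bool" where
  "coxeter_matrix S m \<longleftrightarrow>
     (\<forall>s\<in>S. \<forall>s'\<in>S. m s s' = m s' s) \<and> (\<forall>s\<in>S. m s s = 1) \<and>
     (\<forall>s\<in>S. \<forall>s'\<in>S. s \<noteq> s' \<longrightarrow> m s s' \<noteq> 1)"

definition alt_word :: "'a \<Rightarrow> 'a \<Rightarrow> nat \<Rightarrow> 'a list" where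
  "alt_word r r' n = map (\<lambda>i. if even i then r else r') [0..<n]"

definition coxeter_rels :: "'a set \<Rightarrow> ('a \<Rightarrow> 'a \<Rightarrow> nat) \<Rightarrow> (('a \<times> bool) list \<times> ('a \<times> bool) list) set" where
  "coxeter_rels S m = {(pos_word (alt_word s s' (2 * m s s')), []) | s s'. s \<in> S \<and> s' \<in> S \<and> m s s' \<noteq> 0}"

definition coxeter_system :: "('a, 'c) monoid_scheme \<Rightarrow> 'a set \<Rightarrow> bool" where
  "coxeter_system W S \<longleftrightarrow> group W \<and> S \<subseteq> carrier W \<and>
     (\<exists>m. coxeter_matrix S m \<and>
        (\<exists>\<phi>. \<phi> \<in> iso (presented_group S (coxeter_rels S m)) W \<and>
              (\<forall>s\<in>S. \<phi> (pgen S (coxeter_rels S m) s) = s)))"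

definition reflections :: "('a, 'c) monoid_scheme \<Rightarrow> 'a set \<Rightarrow> 'a set" where
  "reflections W S = {g \<otimes>\<^bsub>W\<^esub> s \<otimes>\<^bsub>W\<^esub> inv\<^bsub>W\<^esub> g | g s. g \<in> carrier W \<and> s \<in> S}"

text \<open>The Coxeter matrix entry m(r,r') of a Coxeter system, i.e. the order of r r'
  (0 = infinite order).\<close>

definition cox_m :: "('a, 'c) monoid_scheme \<Rightarrow> 'a \<Rightarrow> 'a \<Rightarrow> nat" where
  "cox_m W r r' = group.ord W (r \<otimes>\<^bsub>W\<^esub> r')"

definition art_rels :: "('a, 'c) monoid_scheme \<Rightarrow> 'a set \<Rightarrow> (('a \<times> bool) list \<times> ('a \<times> bool) list) set" where
  "art_rels V R = {(pos_word (alt_word r r' (cox_m V r r')), pos_word (alt_word r' r (cox_m V r r')))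
                   | r r'. r \<in> R \<and> r' \<in> R \<and> cox_m V r r' \<noteq> 0}"

definition art_group :: "('a, 'c) monoid_scheme \<Rightarrow> 'a set \<Rightarrow> ('a \<times> bool) list set monoid" where
  "art_group V R = presented_group R (art_rels V R)"

definition art_gen :: "('a, 'c) monoid_scheme \<Rightarrow> 'a set \<Rightarrow> 'a \<Rightarrow> ('a \<times> bool) list set" where
  "art_gen V R r = pgen R (art_rels V R) r"

definition well_stabilized :: "('a, 'c) monoid_scheme \<Rightarrow> 'a list \<Rightarrow> bool" where
  "well_stabilized V rs \<longleftrightarrow>
     hurwitz_stab V rs = hurwitz_stab (art_group V (set rs)) (map (art_gen V (set rs)) rs)"

definition gprod :: "('a, 'c) monoid_scheme \<Rightarrow> 'a list \<Rightarrow> 'a" where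
  "gprod G xs = foldr (\<lambda>x y. x \<otimes>\<^bsub>G\<^esub> y) xs \<one>\<^bsub>G\<^esub>"

definition gen_len :: "('a, 'c) monoid_scheme \<Rightarrow> 'a set \<Rightarrow> 'a \<Rightarrow> nat" where
  "gen_len G Y a = (LEAST k. \<exists>xs. length xs = k \<and> set xs \<subseteq> Y \<union> (m_inv G ` Y) \<and> gprod G xs = a)"

definition red_words :: "('a, 'c) monoid_scheme \<Rightarrow> 'a set \<Rightarrow> 'a \<Rightarrow> 'a list set" where
  "red_words G Y a = {xs. length xs = gen_len G Y a \<and> set xs \<subseteq> Y \<union> (m_inv G ` Y) \<and> gprod G xs = a}"

definition gen_le :: "('a, 'c) monoid_scheme \<Rightarrow> 'a set \<Rightarrow> 'a \<Rightarrow> 'a \<Rightarrow> bool" where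
  "gen_le G Y a b \<longleftrightarrow> gen_len G Y a + gen_len G Y (inv\<^bsub>G\<^esub> a \<otimes>\<^bsub>G\<^esub> b) = gen_len G Y b"

definition gen_interval :: "('a, 'c) monoid_scheme \<Rightarrow> 'a set \<Rightarrow> 'a \<Rightarrow> 'a set" where
  "gen_interval G Y b = {a \<in> carrier G. gen_le G Y a b}"

definition pan_transitive :: "('a, 'c) monoid_scheme \<Rightarrow> 'a set \<Rightarrow> 'a \<Rightarrow> bool" where
  "pan_transitive V T c \<longleftrightarrow>
     (\<forall>a \<in> gen_interval V T c. \<forall>u \<in> red_words V T a. \<forall>v \<in> red_words V T a.
        \<exists>\<beta> \<in> carrier (braid_group (gen_len V T a)). hurwitz_act V \<beta> u = v)"

definition art_star_rels :: "('a, 'c) monoid_scheme \<Rightarrow> 'a set \<Rightarrow> 'a \<Rightarrow> (('a \<times> bool) list \<times> ('a \<times> bool) list) set" where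
  "art_star_rels V T c = {(pos_word u, pos_word v) | a u v.
      a \<in> gen_interval V T c \<and> u \<in> red_words V T a \<and> v \<in> red_words V T a}"

definition art_star :: "('a, 'c) monoid_scheme \<Rightarrow> 'a set \<Rightarrow> 'a \<Rightarrow> ('a \<times> bool) list set monoid" where
  "art_star V T c = presented_group (T \<inter> gen_interval V T c) (art_star_rels V T c)"

end

theory Submission
  imports Defs "HOL-Library.Function_Algebras"
begin

text \<open>Elements of the two factors commute, so a braid acts on a shuffle of a tuple over the first factor
  and a tuple over the second by permuting the shuffle pattern and by acting on either tuple through a
  braid read off from the pattern alone. The same two braids appear in the Coxeter group and in the
  Artin group, which transfers well-stabilizedness from the factors. Reflection length is additive and
  every reduced factorization can be sorted by Hurwitz moves, which transfers pan-transitivity.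

  For the isomorphism, pan-transitivity and well-stabilizedness make the lift of a reduced
  factorization of the Coxeter element from the tuple of simple reflections to the Artin group exist
  and be unique. The lift of a factor depends on that factor alone, which gives the map from the dual
  to the classical presentation; the opposite map exists since dual braid relations imply the classical
  ones. This needs the simple reflections to form a reduced factorization; the lower bound on
  reflection length comes from an affine deformation of the geometric representation, in which the
  roots of any factorization of the Coxeter element must span all simple roots.\<close>

section \<open>Presented groups\<close>

text \<open>The obstacle in the length bound is a degenerate form. In the linear geometric
  representation the vectors of the root span fixed by a Coxeter element are exactly the radical of
  the form, so comparing ranks loses the dimension of the radical, for instance in affine groups.
  Giving each simple reflection a free constant repairs this. All defining relations survive,
  because the two constants of a finite dihedral subgroup can be absorbed by moving the origin
  inside the plane of its two roots. The linear parts do not change, so the roots of a given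
  factorization serve all choices of constants at once, while the constants can be chosen to make
  the Coxeter element translate the origin to any prescribed combination of simple roots.\<close>

lemma pwords_simps [simp]:
  "[] \<in> pwords Y" "x # w \<in> pwords Y \<longleftrightarrow> fst x \<in> Y \<and> w \<in> pwords Y"
  "u @ v \<in> pwords Y \<longleftrightarrow> u \<in> pwords Y \<and> v \<in> pwords Y"
  "pos_word xs \<in> pwords Y \<longleftrightarrow> set xs \<subseteq> Y"
  by (auto simp: pwords_def pos_word_def)

lemma pos_word_simps [simp]:
  "pos_word [] = []" "pos_word (x # xs) = (x, False) # pos_word xs"
  "pos_word (xs @ ys) = pos_word xs @ pos_word ys"
  by (auto simp: pos_word_def)

lemma pres_eq_pwords: "(u, v) \<in> pres_eq Y R \<Longrightarrow> u \<in> pwords Y \<and> v \<in> pwords Y"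
  by (induction rule: pres_eq.induct) auto

text \<open>Only \<open>cancel\<close> and \<open>rel\<close> carry a context; symmetry and
  transitivity inherit it, which makes \<open>pres_eq\<close> a congruence.\<close>

lemma pres_eq_context:
  assumes "(u, v) \<in> pres_eq Y R" "p \<in> pwords Y" "q \<in> pwords Y"
  shows "(p @ u @ q, p @ v @ q) \<in> pres_eq Y R"
  using assms
proof (induction rule: pres_eq.induct)
  case (refl w)
  then show ?case by (intro pres_eq.refl) auto
next
  case (cancel u v g b)
  then show ?case using pres_eq.cancel[of "p @ u" Y "v @ q" g b R] by simp
next
  case (rel l r u v)
  then show ?case using pres_eq.rel[of l r R Y "p @ u" "v @ q"] by simp
qed (blast intro: pres_eq.sym pres_eq.trans)+

lemma pres_eq_append:
  assumes "(u, u') \<in> pres_eq Y R" "(v, v') \<in> pres_eq Y R"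
  shows "(u @ v, u' @ v') \<in> pres_eq Y R"
  using pres_eq_context[OF assms(1), of "[]" v] pres_eq_context[OF assms(2), of u' "[]"]
    pres_eq_pwords[OF assms(1)] pres_eq_pwords[OF assms(2)]
  by (auto intro: pres_eq.trans)

lemma equiv_pres_eq: "equiv (pwords Y) (pres_eq Y R)"
  by (intro equivI refl_onI symI transI)
    (auto intro: pres_eq.refl pres_eq.sym pres_eq.trans dest: pres_eq_pwords)

definition pclass :: "'g set \<Rightarrow> (('g \<times> bool) list \<times> ('g \<times> bool) list) set
    \<Rightarrow> ('g \<times> bool) list \<Rightarrow> ('g \<times> bool) list set" where
  "pclass Y R w = pres_eq Y R `` {w}"

lemma pclass_eq_iff:
  "u \<in> pwords Y \<Longrightarrow> v \<in> pwords Y \<Longrightarrow> pclass Y R u = pclass Y R v \<longleftrightarrow> (u, v) \<in> pres_eq Y R"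
  unfolding pclass_def by (rule eq_equiv_class_iff[OF equiv_pres_eq])

lemma carrier_presented: "carrier (presented_group Y R) = pclass Y R ` pwords Y"
  by (auto simp: presented_group_def quotient_def pclass_def)

lemma one_presented: "one (presented_group Y R) = pclass Y R []"
  by (simp add: presented_group_def pclass_def)

lemma pgen_eq: "pgen Y R g = pclass Y R [(g, False)]"
  by (simp add: pgen_def pclass_def)

text \<open>Multiplication of classes and the Hurwitz action of a class are defined through a chosen
  representative. Equivalence of the choice with \<open>w\<close> lets both be computed on any word
  of the class.\<close>

lemma some_in_pclass:
  assumes "w \<in> pwords Y"
  shows "(w, SOME v. v \<in> pclass Y R w) \<in> pres_eq Y R"
proof -
  have "w \<in> pclass Y R w" using assms by (auto simp: pclass_def intro: pres_eq.refl)
  then have "(SOME v. v \<in> pclass Y R w) \<in> pclass Y R w" by (rule someI)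
  then show ?thesis by (simp add: pclass_def)
qed

lemma mult_presented:
  assumes "u \<in> pwords Y" "v \<in> pwords Y"
  shows "pclass Y R u \<otimes>\<^bsub>presented_group Y R\<^esub> pclass Y R v = pclass Y R (u @ v)"
proof -
  have "(u @ v, (SOME a. a \<in> pclass Y R u) @ (SOME b. b \<in> pclass Y R v)) \<in> pres_eq Y R"
    by (intro pres_eq_append some_in_pclass assms)
  then have "pclass Y R (u @ v)
      = pclass Y R ((SOME a. a \<in> pclass Y R u) @ (SOME b. b \<in> pclass Y R v))"
    using pclass_eq_iff pres_eq_pwords by metis
  then show ?thesis by (simp add: presented_group_def pclass_def)
qed

definition inv_word :: "('g \<times> bool) list \<Rightarrow> ('g \<times> bool) list" where
  "inv_word w = rev (map (\<lambda>(g, b). (g, \<not> b)) w)"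

lemma inv_word_simps [simp]:
  "inv_word [] = []" "inv_word (x # w) = inv_word w @ [(fst x, \<not> snd x)]"
  by (auto simp: inv_word_def split: prod.splits)

lemma inv_word_pwords [simp]: "inv_word w \<in> pwords Y \<longleftrightarrow> w \<in> pwords Y"
  by (induction w) auto

lemma inv_word_inv_word [simp]: "inv_word (inv_word w) = w"
  by (simp add: inv_word_def rev_map o_def case_prod_unfold)

lemma pres_eq_inv_word:
  assumes "w \<in> pwords Y" shows "(w @ inv_word w, []) \<in> pres_eq Y R"
  using assms
proof (induction w)
  case Nil
  then show ?case by (auto intro: pres_eq.refl)
next
  case (Cons x w)
  have "([x] @ (w @ inv_word w) @ [(fst x, \<not> snd x)], [x] @ [] @ [(fst x, \<not> snd x)]) \<in> pres_eq Y R"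
    using Cons by (intro pres_eq_context) auto
  moreover have "([] @ [(fst x, snd x), (fst x, \<not> snd x)] @ [], [] @ []) \<in> pres_eq Y R"
    using Cons by (intro pres_eq.cancel) auto
  ultimately show ?case by (auto intro: pres_eq.trans)
qed

lemma group_presented: "group (presented_group Y R)"
proof (rule groupI)
  fix x assume "x \<in> carrier (presented_group Y R)"
  then obtain w where w: "w \<in> pwords Y" "x = pclass Y R w" by (auto simp: carrier_presented)
  show "\<exists>y\<in>carrier (presented_group Y R). y \<otimes>\<^bsub>presented_group Y R\<^esub> x = one (presented_group Y R)"
  proof
    show "pclass Y R (inv_word w) \<in> carrier (presented_group Y R)"
      using w by (auto simp: carrier_presented)
    show "pclass Y R (inv_word w) \<otimes>\<^bsub>presented_group Y R\<^esub> x = one (presented_group Y R)"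
      using w pres_eq_inv_word[of "inv_word w" Y R]
      by (simp add: mult_presented one_presented pclass_eq_iff)
  qed
qed (auto simp: carrier_presented one_presented mult_presented)

lemma pgen_closed: "g \<in> Y \<Longrightarrow> pgen Y R g \<in> carrier (presented_group Y R)"
  by (auto simp: pgen_eq carrier_presented)

lemma gprod_simps [simp]: "gprod G [] = \<one>\<^bsub>G\<^esub>" "gprod G (x # xs) = x \<otimes>\<^bsub>G\<^esub> gprod G xs"
  by (auto simp: gprod_def)

context group begin

lemma gprod_closed [simp]: "set xs \<subseteq> carrier G \<Longrightarrow> gprod G xs \<in> carrier G"
  by (induction xs) auto

lemma gprod_append:
  "set xs \<subseteq> carrier G \<Longrightarrow> set ys \<subseteq> carrier G \<Longrightarrow> gprod G (xs @ ys) = gprod G xs \<otimes> gprod G ys"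
  by (induction xs) (auto simp: m_assoc)

end

section \<open>Evaluation of words and the universal property of a presentation\<close>

definition word_val :: "('b, 'c) monoid_scheme \<Rightarrow> ('g \<Rightarrow> 'b) \<Rightarrow> ('g \<times> bool) list \<Rightarrow> 'b" where
  "word_val G f w = gprod G (map (\<lambda>(g, b). if b then inv\<^bsub>G\<^esub> (f g) else f g) w)"

lemma word_val_Nil [simp]: "word_val G f [] = \<one>\<^bsub>G\<^esub>"
  and word_val_Cons [simp]:
    "word_val G f (x # w) = (if snd x then inv\<^bsub>G\<^esub> (f (fst x)) else f (fst x)) \<otimes>\<^bsub>G\<^esub> word_val G f w"
  by (auto simp: word_val_def split: prod.splits)

lemma word_val_pos_word: "word_val G f (pos_word xs) = gprod G (map f xs)"
  by (simp add: word_val_def pos_word_def o_def)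

lemma (in group) word_val_closed:
  assumes "f \<in> Y \<rightarrow> carrier G" "w \<in> pwords Y" shows "word_val G f w \<in> carrier G"
  using assms(2) by (induction w) (use assms(1) in auto)

lemma (in group) word_val_append:
  assumes "f \<in> Y \<rightarrow> carrier G" "u \<in> pwords Y" "v \<in> pwords Y"
  shows "word_val G f (u @ v) = word_val G f u \<otimes> word_val G f v"
  using assms(2)
proof (induction u)
  case Nil
  then show ?case using word_val_closed[OF assms(1,3)] by simp
next
  case (Cons x u)
  then have "fst x \<in> Y" "u \<in> pwords Y" by auto
  then show ?case
    using Cons word_val_closed[OF assms(1,3)] word_val_closed[OF assms(1), of u] assms(1)
    by (auto simp: m_assoc Pi_iff)
qed

lemma (in group) word_val_pres_eq:
  assumes f: "f \<in> Y \<rightarrow> carrier G"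
    and rels: "\<And>l r. (l, r) \<in> R \<Longrightarrow> l \<in> pwords Y \<Longrightarrow> r \<in> pwords Y \<Longrightarrow> word_val G f l = word_val G f r"
    and "(u, v) \<in> pres_eq Y R"
  shows "word_val G f u = word_val G f v"
  using assms(3)
proof (induction rule: pres_eq.induct)
  case (cancel u v g b)
  have "word_val G f [(g, b), (g, \<not> b)] = \<one>" using cancel f by (auto simp: Pi_iff)
  moreover have "[(g, b), (g, \<not> b)] \<in> pwords Y" using cancel by simp
  ultimately show ?case
    using cancel word_val_closed[OF f]
    by (simp only: word_val_append[OF f] pwords_simps) simp
next
  case (rel l r u v)
  then show ?case using rels[of l r] by (simp add: word_val_append[OF f])
qed auto

text \<open>Von Dyck's homomorphism: an assignment of the generators that respects the relations
  extends to the presented group. It reads an arbitrary representative, which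
  \<open>word_val_pres_eq\<close> makes harmless.\<close>

definition pres_lift :: "('b, 'c) monoid_scheme \<Rightarrow> ('g \<Rightarrow> 'b) \<Rightarrow> ('g \<times> bool) list set \<Rightarrow> 'b" where
  "pres_lift G f A = word_val G f (SOME w. w \<in> A)"

context
  fixes G :: "('b, 'c) monoid_scheme" and f :: "'g \<Rightarrow> 'b" and Y R
  assumes grp: "group G" and f: "f \<in> Y \<rightarrow> carrier G"
    and rels: "\<And>l r. (l, r) \<in> R \<Longrightarrow> l \<in> pwords Y \<Longrightarrow> r \<in> pwords Y \<Longrightarrow> word_val G f l = word_val G f r"
begin

interpretation group G by (rule grp)

lemma pres_lift_pclass: "w \<in> pwords Y \<Longrightarrow> pres_lift G f (pclass Y R w) = word_val G f w"
  using word_val_pres_eq[OF f rels some_in_pclass[of w Y R]] by (simp add: pres_lift_def)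

lemma pres_lift_hom: "pres_lift G f \<in> hom (presented_group Y R) G"
  by (rule homI)
    (auto simp: carrier_presented mult_presented pres_lift_pclass word_val_append[OF f]
      word_val_closed[OF f])

lemma pres_lift_pgen: "g \<in> Y \<Longrightarrow> pres_lift G f (pgen Y R g) = f g"
  using f by (auto simp: pgen_eq pres_lift_pclass Pi_iff)

end

text \<open>Writes every class as a product of generators, so that a homomorphism out of a presented
  group is determined by its values on generators.\<close>

lemma pclass_eq_word_val:
  assumes "w \<in> pwords Y"
  shows "pclass Y R w = word_val (presented_group Y R) (pgen Y R) w"
  using assms
proof (induction w)
  case Nil
  then show ?case by (simp add: one_presented)
next
  case (Cons x w)
  interpret P: group "presented_group Y R" by (rule group_presented)
  have x: "fst x \<in> Y" and w: "w \<in> pwords Y" using Cons by auto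
  have "([] @ [(fst x, True), (fst x, \<not> True)] @ [], [] @ []) \<in> pres_eq Y R"
    using x by (intro pres_eq.cancel) auto
  then have "pclass Y R [(fst x, True)] \<otimes>\<^bsub>presented_group Y R\<^esub> pgen Y R (fst x)
      = \<one>\<^bsub>presented_group Y R\<^esub>"
    using x by (simp add: pgen_eq mult_presented one_presented pclass_eq_iff)
  then have "inv\<^bsub>presented_group Y R\<^esub> (pgen Y R (fst x)) = pclass Y R [(fst x, True)]"
    using x by (intro P.inv_equality) (auto simp: pgen_eq carrier_presented)
  then have "(if snd x then inv\<^bsub>presented_group Y R\<^esub> (pgen Y R (fst x)) else pgen Y R (fst x))
      = pclass Y R [x]"
    using x by (cases x) (auto simp: pgen_eq)
  then show ?case using Cons x w mult_presented[of "[x]" Y w R] by simp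
qed

lemma word_val_hom:
  assumes "group G" "group H" "h \<in> hom G H" "f \<in> Y \<rightarrow> carrier G" "w \<in> pwords Y"
  shows "h (word_val G f w) = word_val H (h \<circ> f) w"
  using assms(5)
proof (induction w)
  case Nil
  then show ?case using hom_one[OF assms(3,1,2)] by simp
next
  case (Cons x w)
  interpret group_hom G H h using assms by (simp add: group_hom_def group_hom_axioms_def)
  show ?case using Cons G.word_val_closed[OF assms(4), of w] assms(4) by (auto simp: Pi_iff)
qed

lemma word_val_cong:
  "w \<in> pwords Y \<Longrightarrow> (\<And>g. g \<in> Y \<Longrightarrow> f g = f' g) \<Longrightarrow> word_val G f w = word_val G f' w"
  by (induction w) auto

lemma hom_presented_id:
  assumes "h \<in> hom (presented_group Y R) (presented_group Y R)"
    and "\<And>g. g \<in> Y \<Longrightarrow> h (pgen Y R g) = pgen Y R g"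
    and "x \<in> carrier (presented_group Y R)"
  shows "h x = x"
proof -
  obtain w where w: "w \<in> pwords Y" "x = pclass Y R w" using assms(3) by (auto simp: carrier_presented)
  have "h x = word_val (presented_group Y R) (h \<circ> pgen Y R) w"
    using w word_val_hom[OF group_presented group_presented assms(1), of "pgen Y R" Y w]
    by (simp add: pclass_eq_word_val pgen_closed)
  also have "\<dots> = x" using w word_val_cong[of w Y "h \<circ> pgen Y R" "pgen Y R"] assms(2)
    by (simp add: pclass_eq_word_val)
  finally show ?thesis .
qed

lemma presented_iso:
  assumes h: "h \<in> hom (presented_group Y R) (presented_group Z Q)"
    and k: "k \<in> hom (presented_group Z Q) (presented_group Y R)"
    and kh: "\<And>y. y \<in> Y \<Longrightarrow> k (h (pgen Y R y)) = pgen Y R y"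
    and hk: "\<And>z. z \<in> Z \<Longrightarrow> h (k (pgen Z Q z)) = pgen Z Q z"
  shows "presented_group Y R \<cong> presented_group Z Q"
proof -
  have "k (h x) = x" if "x \<in> carrier (presented_group Y R)" for x
    using hom_presented_id[OF hom_compose[OF h k]] kh that by auto
  moreover have "h (k x) = x" if "x \<in> carrier (presented_group Z Q)" for x
    using hom_presented_id[OF hom_compose[OF k h]] hk that by auto
  ultimately have "bij_betw h (carrier (presented_group Y R)) (carrier (presented_group Z Q))"
    using h k by (intro bij_betw_byWitness[where f' = k]) (auto simp: hom_def)
  then show ?thesis using h by (auto simp: is_iso_def iso_def)
qed

section \<open>The Hurwitz action\<close>

text \<open>Trades index updates for a cut of the tuple around the two entries that move; later
  computations rely on this form.\<close>

lemma hurwitz_gen_split [simp]: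
  "hurwitz_gen G (length p, False) (p @ a # b # q) = p @ (a \<otimes>\<^bsub>G\<^esub> b \<otimes>\<^bsub>G\<^esub> inv\<^bsub>G\<^esub> a) # a # q"
  "hurwitz_gen G (length p, True) (p @ a # b # q) = p @ b # (inv\<^bsub>G\<^esub> b \<otimes>\<^bsub>G\<^esub> a \<otimes>\<^bsub>G\<^esub> b) # q"
  by (auto simp: hurwitz_gen_def list_update_append nth_append)

lemma split_adjacent:
  assumes "Suc i < length xs"
  obtains p a b q where "xs = p @ a # b # q" "length p = i"
proof
  show "xs = take i xs @ xs ! i # xs ! Suc i # drop (Suc (Suc i)) xs"
    using assms by (simp add: Cons_nth_drop_Suc)
qed (use assms in simp)

lemma length_hurwitz_gen [simp]: "length (hurwitz_gen G x xs) = length xs"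
  by (auto simp: hurwitz_gen_def Let_def)

lemma length_hurwitz_word [simp]: "length (hurwitz_word G w xs) = length xs"
  by (induction w) (auto simp: hurwitz_word_def)

lemma hurwitz_word_Nil [simp]: "hurwitz_word G [] xs = xs"
  and hurwitz_word_Cons [simp]: "hurwitz_word G (x # w) xs = hurwitz_gen G x (hurwitz_word G w xs)"
  and hurwitz_word_append: "hurwitz_word G (u @ v) xs = hurwitz_word G u (hurwitz_word G v xs)"
  by (auto simp: hurwitz_word_def)

text \<open>For m = 0 the truncated subtraction leaves no letter, as it should.\<close>

abbreviation bgens :: "nat \<Rightarrow> nat set" where "bgens m \<equiv> {i. i < m - 1}"

lemma hurwitz_gen_cases:
  assumes "fst x \<in> bgens (length xs)"
  obtains p a b q where "xs = p @ a # b # q" "x = (length p, False)"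
      "hurwitz_gen G x xs = p @ (a \<otimes>\<^bsub>G\<^esub> b \<otimes>\<^bsub>G\<^esub> inv\<^bsub>G\<^esub> a) # a # q"
  | p a b q where "xs = p @ a # b # q" "x = (length p, True)"
      "hurwitz_gen G x xs = p @ b # (inv\<^bsub>G\<^esub> b \<otimes>\<^bsub>G\<^esub> a \<otimes>\<^bsub>G\<^esub> b) # q"
proof -
  have "Suc (fst x) < length xs" using assms by auto
  then obtain p a b q where xs: "xs = p @ a # b # q" "length p = fst x" by (rule split_adjacent)
  then show thesis using that by (cases x; cases "snd x") auto
qed

context group begin

lemma inv_m_cancel:
  assumes "a \<in> carrier G" "b \<in> carrier G"
  shows "inv a \<otimes> (a \<otimes> b) = b" "a \<otimes> (inv a \<otimes> b) = b"
  using assms by (simp_all flip: m_assoc)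

lemma hurwitz_gen_carrier:
  assumes "fst x \<in> bgens (length xs)" "set xs \<subseteq> carrier G"
  shows "set (hurwitz_gen G x xs) \<subseteq> carrier G"
  using assms(1) by (rule hurwitz_gen_cases[where G = G]) (use assms(2) in auto)

lemma hurwitz_word_carrier:
  assumes "w \<in> pwords (bgens (length xs))" "set xs \<subseteq> carrier G"
  shows "set (hurwitz_word G w xs) \<subseteq> carrier G"
  using assms by (induction w) (auto simp: hurwitz_gen_carrier)

lemma hurwitz_gen_inverse:
  assumes "i \<in> bgens (length xs)" "set xs \<subseteq> carrier G"
  shows "hurwitz_gen G (i, b) (hurwitz_gen G (i, \<not> b) xs) = xs"
proof -
  have "Suc i < length xs" using assms by auto
  then obtain p a c q where xs: "xs = p @ a # c # q" "length p = i" by (rule split_adjacent)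
  then have "a \<in> carrier G" "c \<in> carrier G" using assms by auto
  then show ?thesis using xs(1) by (cases b) (auto simp flip: xs(2) simp: m_assoc inv_m_cancel)
qed

lemma gprod_hurwitz_gen:
  assumes "fst x \<in> bgens (length xs)" "set xs \<subseteq> carrier G"
  shows "gprod G (hurwitz_gen G x xs) = gprod G xs"
  using assms(1)
  by (rule hurwitz_gen_cases[where G = G]) (use assms(2) in \<open>auto simp: gprod_append m_assoc inv_m_cancel\<close>)

lemma gprod_hurwitz_word:
  assumes "w \<in> pwords (bgens (length xs))" "set xs \<subseteq> carrier G"
  shows "gprod G (hurwitz_word G w xs) = gprod G xs"
  using assms by (induction w) (auto simp: hurwitz_word_carrier gprod_hurwitz_gen)

lemma hurwitz_far_commute:
  assumes "i + 2 \<le> j" "Suc j < length xs"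
  shows "hurwitz_word G (pos_word [i, j]) xs = hurwitz_word G (pos_word [j, i]) xs"
proof -
  obtain r c d s where xs: "xs = r @ c # d # s" "length r = j"
    using assms(2) by (rule split_adjacent)
  then have "Suc i < length r" using assms by auto
  then obtain p a b q where r: "r = p @ a # b # q" "length p = i" by (rule split_adjacent)
  have *: "hurwitz_gen G (j, False) (p @ a' # b' # q @ c # d # s)
      = p @ a' # b' # q @ (c \<otimes> d \<otimes> inv c) # c # s" for a' b'
    using hurwitz_gen_split(1)[of G "p @ a' # b' # q" c d s] xs r by auto
  have **: "hurwitz_gen G (i, False) (p @ a # b # t) = p @ (a \<otimes> b \<otimes> inv a) # a # t" for t
    using hurwitz_gen_split(1)[of G p a b t] r by simp
  show ?thesis using xs r(1) by (simp add: * **)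
qed

lemma hurwitz_braid_relation:
  assumes "Suc (Suc i) < length xs" "set xs \<subseteq> carrier G"
  shows "hurwitz_word G (pos_word [i, Suc i, i]) xs = hurwitz_word G (pos_word [Suc i, i, Suc i]) xs"
proof -
  obtain r b c s where xs: "xs = r @ b # c # s" "length r = Suc i"
    using assms(1) by (rule split_adjacent)
  then obtain p a where r: "r = p @ [a]" "length p = i" by (cases r rule: rev_cases) auto
  have *: "hurwitz_gen G (i, False) (p @ x # y # t) = p @ (x \<otimes> y \<otimes> inv x) # x # t" for x y t
    using hurwitz_gen_split(1)[of G p x y t] r by simp
  have **: "hurwitz_gen G (Suc i, False) (p @ z # x # y # t) = p @ z # (x \<otimes> y \<otimes> inv x) # x # t"
    for x y z t
    using hurwitz_gen_split(1)[of G "p @ [z]" x y t] r by simp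
  have "a \<in> carrier G" "b \<in> carrier G" "c \<in> carrier G" using assms xs r by auto
  \<comment> \<open>Both sides turn the triple (a, b, c) into (a b c b^-1 a^-1, a b a^-1,
    a).\<close>
  then show ?thesis using xs r(1) by (simp add: * ** m_assoc inv_mult_group inv_m_cancel)
qed

lemma hurwitz_word_pres_eq:
  assumes "(u, v) \<in> pres_eq (bgens m) (braid_rels m)" "length xs = m" "set xs \<subseteq> carrier G"
  shows "hurwitz_word G u xs = hurwitz_word G v xs"
  using assms
proof (induction arbitrary: xs rule: pres_eq.induct)
  case (cancel u v g b)
  then show ?case
    using hurwitz_gen_inverse[of g "hurwitz_word G v xs" b] hurwitz_word_carrier[of v xs]
    by (simp add: hurwitz_word_append)
next
  case (rel l r u v)
  let ?ys = "hurwitz_word G v xs"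
  have ys: "length ?ys = m" "set ?ys \<subseteq> carrier G" using rel hurwitz_word_carrier[of v xs] by auto
  have "hurwitz_word G l ?ys = hurwitz_word G r ?ys"
    using rel(1) ys hurwitz_far_commute[of _ _ ?ys] hurwitz_braid_relation[of _ ?ys]
    by (auto simp: braid_rels_def less_diff_conv simp del: pos_word_simps)
  then show ?case by (simp add: hurwitz_word_append)
qed auto

lemma hurwitz_act_pclass:
  assumes "w \<in> pwords (bgens (length xs))" "set xs \<subseteq> carrier G"
  shows "hurwitz_act G (pclass (bgens (length xs)) (braid_rels (length xs)) w) xs = hurwitz_word G w xs"
  using hurwitz_word_pres_eq[OF some_in_pclass[OF assms(1)] _ assms(2)] by (simp add: hurwitz_act_def)

lemma hurwitz_act_orbit:
  assumes "set xs \<subseteq> carrier G" "length xs = m"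
  shows "(\<exists>\<beta>\<in>carrier (braid_group m). hurwitz_act G \<beta> xs = ys)
    \<longleftrightarrow> (\<exists>w\<in>pwords (bgens m). hurwitz_word G w xs = ys)"
  using hurwitz_act_pclass[of _ xs] assms by (auto simp: braid_group_def carrier_presented)

end

text \<open>The tuple and its Artin counterpart have the same length, so both stabilizers lie in the
  same braid group. Equality of two sets of classes thus becomes an equivalence for each braid
  word.\<close>

lemma well_stabilized_iff:
  assumes "group V" "set rs \<subseteq> carrier V"
  shows "well_stabilized V rs \<longleftrightarrow> (\<forall>w\<in>pwords (bgens (length rs)). hurwitz_word V w rs = rs \<longleftrightarrow>
    hurwitz_word (art_group V (set rs)) w (map (art_gen V (set rs)) rs) = map (art_gen V (set rs)) rs)"
proof -
  interpret V: group V by fact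
  interpret A: group "art_group V (set rs)" unfolding art_group_def by (rule group_presented)
  have *: "set (map (art_gen V (set rs)) rs) \<subseteq> carrier (art_group V (set rs))"
    by (auto simp: art_group_def art_gen_def pgen_closed)
  have act: "hurwitz_act (art_group V (set rs)) (pclass (bgens (length rs)) (braid_rels (length rs)) w)
      (map (art_gen V (set rs)) rs)
    = hurwitz_word (art_group V (set rs)) w (map (art_gen V (set rs)) rs)"
    if "w \<in> pwords (bgens (length rs))" for w
    using A.hurwitz_act_pclass[OF _ *, of w] that by simp
  have "well_stabilized V rs \<longleftrightarrow>
      (\<forall>\<beta>\<in>pclass (bgens (length rs)) (braid_rels (length rs)) ` pwords (bgens (length rs)).
        hurwitz_act V \<beta> rs = rs \<longleftrightarrow> hurwitz_act (art_group V (set rs)) \<beta>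
          (map (art_gen V (set rs)) rs) = map (art_gen V (set rs)) rs)"
    unfolding well_stabilized_def hurwitz_stab_def braid_group_def carrier_presented length_map
    by blast
  then show ?thesis
    by (simp only: ball_simps(9) act V.hurwitz_act_pclass[OF _ assms(2)] cong: ball_cong)
qed

section \<open>Hurwitz moves under homomorphisms, and orbits as reachability\<close>

lemma hurwitz_gen_hom:
  assumes "group G" "group H" "h \<in> hom G H" "set xs \<subseteq> carrier G" "fst x \<in> bgens (length xs)"
  shows "hurwitz_gen H x (map h xs) = map h (hurwitz_gen G x xs)"
proof -
  interpret group_hom G H h using assms by (simp add: group_hom_def group_hom_axioms_def)
  from assms(5) show ?thesis
  proof (cases rule: hurwitz_gen_cases[where G = G])
    case (1 p a b q)
    then show ?thesis using assms(4) hurwitz_gen_split(1)[of H "map h p" "h a" "h b" "map h q"] by auto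
  next
    case (2 p a b q)
    then show ?thesis using assms(4) hurwitz_gen_split(2)[of H "map h p" "h a" "h b" "map h q"] by auto
  qed
qed

lemma hurwitz_word_hom:
  assumes "group G" "group H" "h \<in> hom G H" "set xs \<subseteq> carrier G" "w \<in> pwords (bgens (length xs))"
  shows "hurwitz_word H w (map h xs) = map h (hurwitz_word G w xs)"
  using assms(5)
  by (induction w) (auto simp: hurwitz_gen_hom[OF assms(1-3)] group.hurwitz_word_carrier assms)

text \<open>Reachability by single moves forgets the braid and its indices. Moves inside a piece of
  a tuple then extend to the whole tuple without renumbering generators.\<close>

definition hurwitz_step :: "('a, 'c) monoid_scheme \<Rightarrow> 'a list \<Rightarrow> 'a list \<Rightarrow> bool" where
  "hurwitz_step G xs ys \<longleftrightarrow> (\<exists>x. fst x \<in> bgens (length xs) \<and> ys = hurwitz_gen G x xs)"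

lemma hurwitz_step_iff:
  "hurwitz_step G xs ys \<longleftrightarrow> (\<exists>p a b q. xs = p @ a # b # q \<and>
     (ys = p @ (a \<otimes>\<^bsub>G\<^esub> b \<otimes>\<^bsub>G\<^esub> inv\<^bsub>G\<^esub> a) # a # q \<or> ys = p @ b # (inv\<^bsub>G\<^esub> b \<otimes>\<^bsub>G\<^esub> a \<otimes>\<^bsub>G\<^esub> b) # q))"
proof
  assume "hurwitz_step G xs ys"
  then show "\<exists>p a b q. xs = p @ a # b # q \<and>
     (ys = p @ (a \<otimes>\<^bsub>G\<^esub> b \<otimes>\<^bsub>G\<^esub> inv\<^bsub>G\<^esub> a) # a # q \<or> ys = p @ b # (inv\<^bsub>G\<^esub> b \<otimes>\<^bsub>G\<^esub> a \<otimes>\<^bsub>G\<^esub> b) # q)"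
    unfolding hurwitz_step_def by (elim exE conjE) (erule hurwitz_gen_cases[where G = G], blast+)
next
  assume "\<exists>p a b q. xs = p @ a # b # q \<and>
     (ys = p @ (a \<otimes>\<^bsub>G\<^esub> b \<otimes>\<^bsub>G\<^esub> inv\<^bsub>G\<^esub> a) # a # q \<or> ys = p @ b # (inv\<^bsub>G\<^esub> b \<otimes>\<^bsub>G\<^esub> a \<otimes>\<^bsub>G\<^esub> b) # q)"
  then obtain p a b q where *: "xs = p @ a # b # q"
     "ys = p @ (a \<otimes>\<^bsub>G\<^esub> b \<otimes>\<^bsub>G\<^esub> inv\<^bsub>G\<^esub> a) # a # q \<or> ys = p @ b # (inv\<^bsub>G\<^esub> b \<otimes>\<^bsub>G\<^esub> a \<otimes>\<^bsub>G\<^esub> b) # q"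
    by blast
  then have "length p \<in> bgens (length xs)" by simp
  then show "hurwitz_step G xs ys"
    using * hurwitz_gen_split[of G p a b q] unfolding hurwitz_step_def by (metis fst_conv)
qed

lemma hurwitz_step_length: "(hurwitz_step G)\<^sup>*\<^sup>* xs ys \<Longrightarrow> length ys = length xs"
  by (induction rule: rtranclp_induct) (auto simp: hurwitz_step_def)

lemma hurwitz_orbit_iff:
  "(\<exists>w\<in>pwords (bgens (length xs)). hurwitz_word G w xs = ys) \<longleftrightarrow> (hurwitz_step G)\<^sup>*\<^sup>* xs ys"
proof
  have "(hurwitz_step G)\<^sup>*\<^sup>* xs (hurwitz_word G w xs)" if "w \<in> pwords (bgens (length xs))" for w
    using that
  proof (induction w)
    case (Cons x w)
    then have "hurwitz_step G (hurwitz_word G w xs) (hurwitz_word G (x # w) xs)"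
      unfolding hurwitz_step_def by (intro exI[of _ x]) auto
    then show ?case using Cons by auto
  qed simp
  then show "\<exists>w\<in>pwords (bgens (length xs)). hurwitz_word G w xs = ys \<Longrightarrow> (hurwitz_step G)\<^sup>*\<^sup>* xs ys"
    by auto
next
  assume "(hurwitz_step G)\<^sup>*\<^sup>* xs ys"
  then show "\<exists>w\<in>pwords (bgens (length xs)). hurwitz_word G w xs = ys"
  proof (induction rule: rtranclp_induct)
    case base
    then show ?case by (auto intro!: bexI[of _ "[]"])
  next
    case (step ys zs)
    then obtain w x where w: "w \<in> pwords (bgens (length xs))" "hurwitz_word G w xs = ys"
      and x: "fst x \<in> bgens (length xs)" "zs = hurwitz_gen G x ys"
      by (auto simp: hurwitz_step_def)
    then show ?case by (intro bexI[of _ "x # w"]) auto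
  qed
qed

lemma hurwitz_step_context:
  assumes "hurwitz_step G xs ys" shows "hurwitz_step G (r @ xs @ s) (r @ ys @ s)"
proof -
  obtain p a b q where *: "xs = p @ a # b # q"
     "ys = p @ (a \<otimes>\<^bsub>G\<^esub> b \<otimes>\<^bsub>G\<^esub> inv\<^bsub>G\<^esub> a) # a # q \<or> ys = p @ b # (inv\<^bsub>G\<^esub> b \<otimes>\<^bsub>G\<^esub> a \<otimes>\<^bsub>G\<^esub> b) # q"
    using assms by (auto simp: hurwitz_step_iff)
  then show ?thesis
    unfolding hurwitz_step_iff
    by (intro exI[of _ "r @ p"] exI[of _ a] exI[of _ b] exI[of _ "q @ s"]) auto
qed

lemma hurwitz_steps_context:
  "(hurwitz_step G)\<^sup>*\<^sup>* xs ys \<Longrightarrow> (hurwitz_step G)\<^sup>*\<^sup>* (r @ xs @ s) (r @ ys @ s)"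
  by (induction rule: rtranclp_induct) (auto dest: hurwitz_step_context[of G _ _ r s])

context group begin

lemma hurwitz_steps_carrier:
  "(hurwitz_step G)\<^sup>*\<^sup>* xs ys \<Longrightarrow> set xs \<subseteq> carrier G \<Longrightarrow> set ys \<subseteq> carrier G"
  by (induction rule: rtranclp_induct) (use hurwitz_gen_carrier in \<open>auto simp: hurwitz_step_def subset_iff\<close>)

lemma gprod_hurwitz_steps:
  "(hurwitz_step G)\<^sup>*\<^sup>* xs ys \<Longrightarrow> set xs \<subseteq> carrier G \<Longrightarrow> gprod G ys = gprod G xs"
  using hurwitz_orbit_iff[of xs G ys] gprod_hurwitz_word by blast

lemma hurwitz_step_sym:
  assumes "hurwitz_step G xs ys" "set xs \<subseteq> carrier G" shows "hurwitz_step G ys xs"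
proof -
  obtain i b where i: "i \<in> bgens (length xs)" "ys = hurwitz_gen G (i, b) xs"
    using assms by (auto simp: hurwitz_step_def)
  then show ?thesis
    using hurwitz_gen_inverse[OF i(1) assms(2), of "\<not> b"] unfolding hurwitz_step_def
    by (intro exI[of _ "(i, \<not> b)"]) auto
qed

lemma hurwitz_steps_sym:
  "(hurwitz_step G)\<^sup>*\<^sup>* xs ys \<Longrightarrow> set xs \<subseteq> carrier G \<Longrightarrow> (hurwitz_step G)\<^sup>*\<^sup>* ys xs"
proof (induction rule: rtranclp_induct)
  case (step ys zs)
  then have "hurwitz_step G zs ys" using hurwitz_step_sym hurwitz_steps_carrier by blast
  then show ?case using step by (auto intro: converse_rtranclp_into_rtranclp)
qed auto

end

lemma hurwitz_steps_hom:
  assumes "group G" "group H" "h \<in> hom G H" "(hurwitz_step G)\<^sup>*\<^sup>* xs ys" "set xs \<subseteq> carrier G"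
  shows "(hurwitz_step H)\<^sup>*\<^sup>* (map h xs) (map h ys)"
  using hurwitz_word_hom[OF assms(1-3,5)] assms(4) hurwitz_orbit_iff[of "map h xs" H "map h ys"]
  unfolding hurwitz_orbit_iff[symmetric] by auto

section \<open>Groups generated by a conjugation-closed set of involutions\<close>

text \<open>Lengths, intervals and Hurwitz moves depend on reflections only through these
  properties. The product group enters through this locale, with its own set of involutions, rather
  than through a Coxeter presentation.\<close>

locale involution_group = group G for G :: "('a, 'c) monoid_scheme" (structure) +
  fixes T :: "'a set"
  assumes T_carrier: "T \<subseteq> carrier G"
    and T_square: "t \<in> T \<Longrightarrow> t \<otimes> t = \<one>"
    and T_conj: "t \<in> T \<Longrightarrow> g \<in> carrier G \<Longrightarrow> g \<otimes> t \<otimes> inv g \<in> T"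
    and T_generates: "a \<in> carrier G \<Longrightarrow> \<exists>xs. set xs \<subseteq> T \<and> gprod G xs = a"
begin

lemma T_closed: "t \<in> T \<Longrightarrow> t \<in> carrier G"
  using T_carrier by blast

lemma T_inv: "t \<in> T \<Longrightarrow> inv t = t"
  using T_square T_closed by (simp add: inv_equality)

lemma T_letters [simp]: "T \<union> m_inv G ` T = T"
  using T_inv by auto

lemma red_words_iff:
  "xs \<in> red_words G T a \<longleftrightarrow> set xs \<subseteq> T \<and> gprod G xs = a \<and> length xs = gen_len G T a"
  by (auto simp: red_words_def)

lemma gprod_T: "set xs \<subseteq> T \<Longrightarrow> gprod G xs \<in> carrier G"
  using T_carrier by (intro gprod_closed) auto

lemma red_words_closed: "xs \<in> red_words G T a \<Longrightarrow> a \<in> carrier G"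
  using gprod_T by (auto simp: red_words_iff)

lemma gen_len_le: "set xs \<subseteq> T \<Longrightarrow> gen_len G T (gprod G xs) \<le> length xs"
  unfolding gen_len_def by (rule Least_le) auto

lemma red_words_ex:
  assumes "a \<in> carrier G" obtains xs where "xs \<in> red_words G T a"
proof -
  obtain ys where "set ys \<subseteq> T" "gprod G ys = a" using T_generates[OF assms] by blast
  then have "\<exists>k xs. length xs = k \<and> set xs \<subseteq> T \<union> m_inv G ` T \<and> gprod G xs = a" by auto
  from LeastI_ex[OF this] show thesis using that by (auto simp: red_words_def gen_len_def)
qed

lemma gen_len_mult_le:
  assumes "a \<in> carrier G" "b \<in> carrier G"
  shows "gen_len G T (a \<otimes> b) \<le> gen_len G T a + gen_len G T b"
proof -
  obtain xs ys where "xs \<in> red_words G T a" "ys \<in> red_words G T b"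
    using assms red_words_ex by metis
  then show ?thesis
    using gen_len_le[of "xs @ ys"] T_carrier by (auto simp: red_words_iff gprod_append subset_trans)
qed

lemma gprod_conj:
  assumes "set xs \<subseteq> carrier G" "g \<in> carrier G"
  shows "gprod G (map (\<lambda>x. g \<otimes> x \<otimes> inv g) xs) = g \<otimes> gprod G xs \<otimes> inv g"
  using assms by (induction xs) (auto simp: m_assoc inv_m_cancel)

lemma gen_len_conj_le:
  assumes "a \<in> carrier G" "g \<in> carrier G"
  shows "gen_len G T (g \<otimes> a \<otimes> inv g) \<le> gen_len G T a"
proof -
  obtain xs where "xs \<in> red_words G T a" using assms red_words_ex by metis
  then show ?thesis
    using gen_len_le[of "map (\<lambda>x. g \<otimes> x \<otimes> inv g) xs"] T_conj[OF _ assms(2)] T_carrier assms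
    by (auto simp: red_words_iff gprod_conj image_subset_iff subset_iff)
qed

lemma interval_iff:
  "a \<in> gen_interval G T c \<longleftrightarrow>
    a \<in> carrier G \<and> gen_len G T a + gen_len G T (inv a \<otimes> c) = gen_len G T c"
  by (simp add: gen_interval_def gen_le_def)

text \<open>Conjugating \<open>u\<close> past \<open>x\<close> costs no length, so the complement of
  \<open>gprod G x\<close> in \<open>c\<close> has length at most that of \<open>u\<close> plus that
  of \<open>v\<close>. Subadditivity then turns all inequalities into equalities. Conjugation
  invariance is what admits infixes and not just prefixes.\<close>

lemma red_words_infix:
  assumes "u @ x @ v \<in> red_words G T c"
  shows "x \<in> red_words G T (gprod G x)" "gprod G x \<in> gen_interval G T c"
proof -
  let ?U = "gprod G u" and ?X = "gprod G x" and ?V = "gprod G v"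
  have sub: "set u \<subseteq> T" "set x \<subseteq> T" "set v \<subseteq> T" using assms by (auto simp: red_words_iff)
  note cl = this[THEN gprod_T] this[THEN subset_trans[OF _ T_carrier]]
  have c: "c = ?U \<otimes> (?X \<otimes> ?V)" and c': "length u + length x + length v = gen_len G T c"
    using assms cl by (auto simp: red_words_iff gprod_append)
  have eq: "inv ?X \<otimes> c = (inv ?X \<otimes> ?U \<otimes> inv (inv ?X)) \<otimes> ?V"
    using cl c by (simp add: m_assoc)
  have "gen_len G T (inv ?X \<otimes> c) \<le> gen_len G T ?U + gen_len G T ?V"
    unfolding eq using cl gen_len_mult_le[of "inv ?X \<otimes> ?U \<otimes> inv (inv ?X)" ?V]
      gen_len_conj_le[of ?U "inv ?X"] by simp
  then have 1: "gen_len G T (inv ?X \<otimes> c) \<le> length u + length v"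
    using gen_len_le[OF sub(1)] gen_len_le[OF sub(3)] by linarith
  have 2: "gen_len G T c \<le> gen_len G T ?X + gen_len G T (inv ?X \<otimes> c)"
    using gen_len_mult_le[of ?X "inv ?X \<otimes> c"] cl c by (simp add: inv_m_cancel)
  show "x \<in> red_words G T ?X" "?X \<in> gen_interval G T c"
    using 1 2 c' gen_len_le[OF sub(2)] sub cl by (auto simp: red_words_iff interval_iff)
qed

text \<open>Conversely, what lies below \<open>c\<close> is a prefix of a reduced factorization of
  \<open>c\<close>; statements about smaller elements are reduced to factorizations of
  \<open>c\<close> in this way.\<close>

lemma red_words_complete:
  assumes "a \<in> gen_interval G T c" "c \<in> carrier G"
    and "u \<in> red_words G T a" "x \<in> red_words G T (inv a \<otimes> c)"
  shows "u @ x \<in> red_words G T c"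
proof -
  have "set u \<subseteq> carrier G" "set x \<subseteq> carrier G"
    using assms T_carrier by (auto simp: red_words_iff)
  then show ?thesis
    using assms by (simp add: red_words_iff interval_iff gprod_append inv_m_cancel)
qed

lemma hurwitz_step_T:
  assumes "hurwitz_step G xs ys" "set xs \<subseteq> T" shows "set ys \<subseteq> T"
proof -
  obtain p a b q where *: "xs = p @ a # b # q"
     "ys = p @ (a \<otimes> b \<otimes> inv a) # a # q \<or> ys = p @ b # (inv b \<otimes> a \<otimes> b) # q"
    using assms by (auto simp: hurwitz_step_iff)
  have "a \<in> T" "b \<in> T" using assms * by auto
  then show ?thesis
    using T_conj[of b a] T_conj[of a "inv b"] T_closed assms(2) * by auto
qed

lemma hurwitz_steps_red_words:
  assumes "(hurwitz_step G)\<^sup>*\<^sup>* xs ys" "xs \<in> red_words G T a" shows "ys \<in> red_words G T a"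
proof -
  have "set ys \<subseteq> T"
    using assms by (induction rule: rtranclp_induct) (auto simp: red_words_iff dest: hurwitz_step_T)
  then show ?thesis
    using gprod_hurwitz_steps[OF assms(1)] hurwitz_step_length[OF assms(1)] assms(2) T_carrier
    by (auto simp: red_words_iff)
qed

lemma pan_transitive_iff:
  "pan_transitive G T c \<longleftrightarrow> (\<forall>a \<in> gen_interval G T c. \<forall>u \<in> red_words G T a. \<forall>v \<in> red_words G T a.
     (hurwitz_step G)\<^sup>*\<^sup>* u v)"
proof -
  have "(\<exists>\<beta> \<in> carrier (braid_group (gen_len G T a)). hurwitz_act G \<beta> u = v) \<longleftrightarrow> (hurwitz_step G)\<^sup>*\<^sup>* u v"
    if "u \<in> red_words G T a" for a u v
    using hurwitz_act_orbit[of u "gen_len G T a" v] hurwitz_orbit_iff[of u G v] that T_carrier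
    by (auto simp: red_words_iff)
  then show ?thesis unfolding pan_transitive_def by auto
qed

end

section \<open>Reflection length of Coxeter elements\<close>

lemma alt_word_0 [simp]: "alt_word r r' 0 = []"
  and alt_word_Suc: "alt_word r r' (Suc n) = r # alt_word r' r n"
proof -
  show "alt_word r r' (Suc n) = r # alt_word r' r n"
    unfolding alt_word_def
    by (simp add: upt_conv_Cons del: upt_Suc flip: map_Suc_upt)
qed (simp add: alt_word_def)

text \<open>This is U_(k-1)(d/2) for the Chebyshev polynomials U of the second kind. The shift of
  the index gives the value 0 at \<open>k = 0\<close>, matching sin (k t) / sin t for d = 2 cos
  t.\<close>

fun chebyshev :: "real \<Rightarrow> nat \<Rightarrow> real" where
  "chebyshev d 0 = 0"
| "chebyshev d (Suc 0) = 1"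
| "chebyshev d (Suc (Suc k)) = d * chebyshev d (Suc k) - chebyshev d k"

text \<open>A Cassini identity: it says that the k-th power of the matrix with rows (d, -1) and (1,
  0) has determinant 1.\<close>

lemma chebyshev_cassini:
  "(chebyshev d (Suc k))\<^sup>2 - d * chebyshev d k * chebyshev d (Suc k) + (chebyshev d k)\<^sup>2 = 1"
  by (induction k) (auto simp: power2_eq_square algebra_simps)

lemma chebyshev_sin: "chebyshev (2 * cos t) k * sin t = sin (real k * t)"
proof (induction k rule: induct_nat_012)
  case (ge2 k)
  have "sin (real (Suc (Suc k)) * t) = 2 * cos t * sin (real (Suc k) * t) - sin (real k * t)"
    using sin_add[of "real (Suc k) * t" t] sin_diff[of "real (Suc k) * t" t] by (simp add: algebra_simps)
  then show ?case using ge2 by (simp add: algebra_simps)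
qed auto

lemma chebyshev_root:
  assumes "2 \<le> k" shows "chebyshev (2 * cos (pi / real k)) k = 0"
proof -
  \<comment> \<open>The angle lies strictly between 0 and pi. For \<open>k = 1\<close> the sine
    vanishes and the Chebyshev number is 1, so diagonal relations are treated apart later.\<close>
  have "0 < sin (pi / real k)" using assms by (intro sin_gt_zero) (auto simp: field_simps)
  then show ?thesis using chebyshev_sin[of "pi / real k" k] assms by simp
qed

text \<open>Twice the usual bilinear form, so that roots have square 2. For an infinite bond,
  encoded by 0, there is no relation to satisfy, and the entry is set to 0.\<close>

definition cox_form :: "('a \<Rightarrow> 'a \<Rightarrow> nat) \<Rightarrow> 'a \<Rightarrow> 'a \<Rightarrow> real" where
  "cox_form m s t =
     (if s = t then 2 else if m s t = 0 then 0 else - 2 * cos (pi / real (m s t)))"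

definition coroot :: "'a set \<Rightarrow> ('a \<Rightarrow> 'a \<Rightarrow> nat) \<Rightarrow> 'a \<Rightarrow> ('a \<Rightarrow> real) \<Rightarrow> real" where
  "coroot S m s f = (\<Sum>t\<in>S. cox_form m s t * f t)"

definition delta :: "'a \<Rightarrow> 'a \<Rightarrow> real" where
  "delta s t = (if t = s then 1 else 0)"

text \<open>The reflection along the simple root \<open>delta s\<close> in the hyperplane where the
  coroot takes the value \<open>- b s\<close>. Zero constants give the geometric
  representation.\<close>

definition affine_refl :: "'a set \<Rightarrow> ('a \<Rightarrow> 'a \<Rightarrow> nat) \<Rightarrow> ('a \<Rightarrow> real) \<Rightarrow> 'a \<Rightarrow> ('a \<Rightarrow> real) \<Rightarrow> 'a \<Rightarrow> real" where
  "affine_refl S m b s f = (\<lambda>t. f t - (coroot S m s f + b s) * delta s t)"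

text \<open>The inverse mark of a letter is ignored because each generator acts as an
  involution.\<close>

definition affine_act :: "'a set \<Rightarrow> ('a \<Rightarrow> 'a \<Rightarrow> nat) \<Rightarrow> ('a \<Rightarrow> real) \<Rightarrow> ('a \<times> bool) list \<Rightarrow> ('a \<Rightarrow> real) \<Rightarrow> 'a \<Rightarrow> real" where
  "affine_act S m b w = foldr (\<lambda>x. affine_refl S m b (fst x)) w"

lemma affine_act_simps [simp]:
  "affine_act S m b [] f = f"
  "affine_act S m b (x # w) f = affine_refl S m b (fst x) (affine_act S m b w f)"
  "affine_act S m b (u @ v) f = affine_act S m b u (affine_act S m b v f)"
  by (auto simp: affine_act_def)

lemma coroot_add: "coroot S m s (\<lambda>t. f t + k * g t) = coroot S m s f + k * coroot S m s g"
  by (simp add: coroot_def sum.distrib sum_distrib_left algebra_simps)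

lemma coroot_delta: "finite S \<Longrightarrow> t \<in> S \<Longrightarrow> coroot S m s (delta t) = cox_form m s t"
  by (simp add: coroot_def delta_def if_distrib cong: if_cong)

lemma coroot_diff_delta:
  "finite S \<Longrightarrow> t \<in> S \<Longrightarrow> coroot S m s (\<lambda>u. f u - k * delta t u) = coroot S m s f - k * cox_form m s t"
  using coroot_add[of S m s f "- k" "delta t"] by (simp add: coroot_delta)

lemma affine_refl_square:
  "finite S \<Longrightarrow> s \<in> S \<Longrightarrow> affine_refl S m b s (affine_refl S m b s f) = f"
  by (simp add: affine_refl_def coroot_diff_delta) (simp add: cox_form_def algebra_simps)

text \<open>With Chebyshev numbers as coefficients, the powers of a product of two reflections have a
  closed form; it degenerates to the identity when the angle is a suitable fraction of pi.\<close>

lemma affine_refl_power: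
  fixes S m b s t f
  defines "x \<equiv> coroot S m s f + b s" and "y \<equiv> coroot S m t f + b t"
  assumes S: "finite S" "s \<in> S" "t \<in> S" "s \<noteq> t"
    and d: "cox_form m s t = - d" "cox_form m t s = - d"
  shows "((affine_refl S m b s \<circ> affine_refl S m b t) ^^ k) f = (\<lambda>u. f u
     - (chebyshev d k * (chebyshev d k * x + chebyshev d (Suc k) * y)) * delta s u
     - (chebyshev d k * ((d * chebyshev d k - chebyshev d (Suc k)) * x + chebyshev d k * y)) * delta t u)"
proof (induction k)
  case 0
  then show ?case by simp
next
  case (Suc k)
  \<comment> \<open>\<open>P\<close> and \<open>Q\<close> are the amounts subtracted so far along
    the roots of \<open>s\<close> and \<open>t\<close>; \<open>Y\<close> and \<open>Z\<close> below
    are the further amounts subtracted by applying \<open>t\<close> and then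
    \<open>s\<close>.\<close>
  define p where "p = chebyshev d k"
  define q where "q = chebyshev d (Suc k)"
  define P where "P = p * (p * x + q * y)"
  define Q where "Q = p * ((d * p - q) * x + p * y)"
  define g where "g = (\<lambda>u. f u - P * delta s u - Q * delta t u)"
  have IH: "((affine_refl S m b s \<circ> affine_refl S m b t) ^^ k) f = g"
    unfolding g_def P_def Q_def p_def q_def by (rule Suc)
  have form: "cox_form m s s = 2" "cox_form m t t = 2" by (simp_all add: cox_form_def)
  define Y where "Y = y + d * P - 2 * Q"
  have Y: "coroot S m t g + b t = Y"
    using S d form by (simp add: g_def coroot_diff_delta Y_def y_def)
  define Z where "Z = x - 2 * P + d * Q + d * Y"
  have 1: "affine_refl S m b t g = (\<lambda>u. g u - Y * delta t u)"
    by (simp add: affine_refl_def Y)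
  have "coroot S m s (\<lambda>u. g u - Y * delta t u) + b s = Z"
    using S d form by (simp add: g_def coroot_diff_delta Z_def x_def)
  then have 2: "affine_refl S m b s (affine_refl S m b t g) = (\<lambda>u. g u - Y * delta t u - Z * delta s u)"
    by (simp add: 1) (simp add: affine_refl_def)
  \<comment> \<open>Rewriting by this quadratic identity brings the updated coefficients back to the
    closed form, with \<open>k\<close> replaced by its successor.\<close>
  have cas: "q\<^sup>2 = 1 + d * p * q - p\<^sup>2"
    using chebyshev_cassini[of d k] by (simp add: p_def q_def)
  have Q': "Q + Y = q * ((d * q - (d * q - p)) * x + q * y)"
  proof -
    have "Q + Y = p * q * x + (1 + d * p * q - p\<^sup>2) * y"
      by (simp add: Y_def P_def Q_def power2_eq_square algebra_simps)
    then show ?thesis by (simp flip: cas) (simp add: power2_eq_square algebra_simps)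
  qed
  have P': "P + Z = q * (q * x + (d * q - p) * y)"
  proof -
    have "P + Z = (1 + d * p * q - p\<^sup>2) * x + (d * (1 + d * p * q - p\<^sup>2) - p * q) * y"
      by (simp add: Z_def Y_def P_def Q_def power2_eq_square algebra_simps)
    then show ?thesis by (simp flip: cas) (simp add: power2_eq_square algebra_simps)
  qed
  have "((affine_refl S m b s \<circ> affine_refl S m b t) ^^ Suc k) f
      = (\<lambda>u. g u - Y * delta t u - Z * delta s u)"
    by (simp only: funpow.simps comp_apply IH 2)
  also have "\<dots> = (\<lambda>u. f u - (P + Z) * delta s u - (Q + Y) * delta t u)"
    by (simp add: g_def algebra_simps)
  finally show ?case unfolding P' Q' by (simp only: p_def q_def chebyshev.simps)
qed

lemma affine_act_alt_word:
  "affine_act S m b (pos_word (alt_word s t (2 * k))) f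
    = ((affine_refl S m b s \<circ> affine_refl S m b t) ^^ k) f"
  by (induction k) (auto simp: alt_word_Suc)

lemma affine_act_pres_eq:
  assumes S: "finite S" and m: "coxeter_matrix S m" and "(u, v) \<in> pres_eq S (coxeter_rels S m)"
  shows "affine_act S m b u f = affine_act S m b v f"
  using assms(3)
proof (induction arbitrary: f rule: pres_eq.induct)
  case (cancel u v g b')
  then show ?case using S by (simp add: affine_refl_square)
next
  case (rel l r u v)
  have "affine_act S m b l h = affine_act S m b r h" for h
  proof -
    obtain s t where st: "l = pos_word (alt_word s t (2 * m s t))" "r = []" "s \<in> S" "t \<in> S" "m s t \<noteq> 0"
      using rel(1) by (auto simp: coxeter_rels_def)
    show ?thesis
    proof (cases "s = t")
      case True
      \<comment> \<open>The diagonal relation is the word \<open>s s\<close>, which acts trivially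
        because a reflection is an involution.\<close>
      then have "m s t = 1" using st m by (auto simp: coxeter_matrix_def)
      then show ?thesis
        using st True S affine_act_alt_word[of S m b t t 1 h] by (simp add: affine_refl_square)
    next
      case False
      define d where "d = 2 * cos (pi / real (m s t))"
      have m2: "m s t = m t s" "2 \<le> m s t"
        using m st False unfolding coxeter_matrix_def by (force, metis less_2_cases not_less One_nat_def)
      then have "cox_form m s t = - d" "cox_form m t s = - d"
        using False st by (auto simp: cox_form_def d_def)
      moreover have "chebyshev d (m s t) = 0" unfolding d_def by (rule chebyshev_root[OF m2(2)])
      ultimately show ?thesis
        using st affine_refl_power[OF S st(3,4) False, where m = m and d = d and b = b and f = h and k = "m s t"]
        by (simp add: affine_act_alt_word)
    qed
  qed
  then show ?case by simp
qed auto

text \<open>Isolates the linear part, which is the action with zero constants whatever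
  \<open>b\<close> is. Hence the direction of a reflection does not depend on
  \<open>b\<close>.\<close>

lemma affine_refl_add:
  "affine_refl S m b s (\<lambda>t. f t + k * g t)
    = (\<lambda>t. affine_refl S m b s f t + k * affine_refl S m (\<lambda>_. 0) s g t)"
  by (auto simp: affine_refl_def coroot_add algebra_simps)

lemma affine_act_add:
  "affine_act S m b w (\<lambda>t. f t + k * g t)
    = (\<lambda>t. affine_act S m b w f t + k * affine_act S m (\<lambda>_. 0) w g t)"
  by (induction w) (auto simp: affine_refl_add)

lemma affine_act_inv_word:
  assumes "finite S" "u \<in> pwords S"
  shows "affine_act S m b u (affine_act S m b (inv_word u) f) = f"
  using assms(2)
proof (induction u arbitrary: f)
  case (Cons x u)
  then show ?case using assms(1) by (simp add: affine_refl_square)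
qed simp

interpretation fun_vs: vector_space "\<lambda>(c::real) (f :: 'a \<Rightarrow> real) x. c * f x"
  by unfold_locales (auto simp: fun_eq_iff algebra_simps)

text \<open>Conjugation carries the simple root of \<open>s\<close> to its image under the linear
  part of \<open>u\<close>. Every point moves along this one root; only the amount depends on
  \<open>b\<close> and \<open>f\<close>.\<close>

lemma affine_act_reflection:
  assumes "finite S" "u \<in> pwords S" "s \<in> S"
  shows "affine_act S m b (u @ (s, e) # inv_word u) f - f
    \<in> fun_vs.span {affine_act S m (\<lambda>_. 0) u (delta s)}"
proof -
  define h where "h = affine_act S m b (inv_word u) f"
  define r where "r = coroot S m s h + b s"
  have "affine_act S m b (u @ (s, e) # inv_word u) f
      = affine_act S m b u (\<lambda>t. h t + (- r) * delta s t)"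
    by (simp add: affine_refl_def flip: h_def) (simp add: r_def algebra_simps)
  also have "\<dots> = (\<lambda>t. f t + (- r) * affine_act S m (\<lambda>_. 0) u (delta s) t)"
    unfolding affine_act_add using affine_act_inv_word[OF assms(1,2)] by (simp add: h_def)
  finally have "affine_act S m b (u @ (s, e) # inv_word u) f - f
      = (\<lambda>t. (- r) * affine_act S m (\<lambda>_. 0) u (delta s) t)"
    by (auto simp: fun_eq_iff)
  moreover have "(\<lambda>t. (- r) * affine_act S m (\<lambda>_. 0) u (delta s) t)
      \<in> fun_vs.span {affine_act S m (\<lambda>_. 0) u (delta s)}"
    by (intro fun_vs.span_scale fun_vs.span_base) simp
  ultimately show ?thesis by simp
qed

lemma affine_act_cong:
  "(\<And>s. s \<in> fst ` set w \<Longrightarrow> b s = b' s) \<Longrightarrow> affine_act S m b w f = affine_act S m b' w f"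
  by (induction w) (auto simp: affine_refl_def)

text \<open>The translation part is free, so a Coxeter element moves the origin anywhere.\<close>

lemma affine_act_coxeter_element:
  assumes "distinct ss"
  shows "\<exists>b. affine_act S m b (pos_word ss) (\<lambda>_. 0) = (\<lambda>t. if t \<in> set ss then g t else 0)"
  using assms
proof (induction ss)
  case (Cons s ss)
  then obtain b where b: "affine_act S m b (pos_word ss) (\<lambda>_. 0) = (\<lambda>t. if t \<in> set ss then g t else 0)"
    (is "_ = ?g") by auto
  \<comment> \<open>Since \<open>?g\<close> vanishes at \<open>s\<close>, this constant makes the
    reflection in \<open>s\<close> add exactly \<open>g s\<close> in that coordinate. The remaining
    generators differ from \<open>s\<close> and do not see the change.\<close>
  define b' where "b' = b(s := - g s - coroot S m s ?g)"
  have "affine_act S m b' (pos_word ss) (\<lambda>_. 0) = affine_act S m b (pos_word ss) (\<lambda>_. 0)"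
    by (rule affine_act_cong) (use Cons in \<open>auto simp: b'_def pos_word_def\<close>)
  then have "affine_act S m b' (pos_word (s # ss)) (\<lambda>_. 0) = affine_refl S m b' s ?g"
    using b by simp
  also have "\<dots> = (\<lambda>t. if t \<in> set (s # ss) then g t else 0)"
    using Cons by (auto simp: affine_refl_def b'_def delta_def fun_eq_iff)
  finally show ?case by blast
qed auto

lemma independent_delta: "finite S \<Longrightarrow> fun_vs.independent (delta ` S)"
proof (rule fun_vs.independent_if_scalars_zero)
  fix c :: "('a \<Rightarrow> real) \<Rightarrow> real" and x
  assume S: "finite S" and 0: "(\<Sum>x\<in>delta ` S. (\<lambda>t. c x * x t)) = 0" and x: "x \<in> delta ` S"
  have inj: "inj_on delta S" by (auto simp: inj_on_def delta_def fun_eq_iff split: if_splits)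
  have sum_apply: "(\<Sum>x\<in>A. F x) t = (\<Sum>x\<in>A. F x t)" if "finite A" for A and F :: "'a \<Rightarrow> 'a \<Rightarrow> real" and t
    using that by (induction A rule: finite_induct) auto
  obtain s where s: "s \<in> S" "x = delta s" using x by auto
  have "0 = (\<Sum>r\<in>S. (\<lambda>t. c (delta r) * delta r t)) s"
    using 0 by (simp add: sum.reindex[OF inj] o_def)
  also have "\<dots> = (\<Sum>r\<in>S. c (delta r) * delta r s)"
    using S by (simp add: sum_apply)
  also have "\<dots> = c (delta s)"
    using S s by (simp add: delta_def if_distrib cong: if_cong)
  finally show "c x = 0" using s by simp
qed simp

lemma card_delta: "card (delta ` S) = card S"
  by (intro card_image) (auto simp: inj_on_def delta_def fun_eq_iff split: if_splits)

section \<open>Coxeter systems through words, and the length of a Coxeter element\<close>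

lemma (in group) word_val_inv_word:
  assumes "f \<in> Y \<rightarrow> carrier G" "w \<in> pwords Y"
  shows "word_val G f (inv_word w) = inv (word_val G f w)"
proof -
  have "word_val G f (inv_word w @ w) = \<one>"
    using word_val_pres_eq[OF assms(1), of "{}", OF _ pres_eq_inv_word[of "inv_word w"]] assms(2)
    by simp
  then show ?thesis
    using assms word_val_closed[OF assms(1)]
    by (intro inv_equality[symmetric]) (auto simp: word_val_append[OF assms(1)])
qed

text \<open>Unpacks the isomorphism into what is used of it: equality in \<open>W\<close> is
  equality modulo the relations, and every element is spelled by a word.\<close>

lemma coxeter_systemE:
  assumes "coxeter_system W S"
  obtains m where "coxeter_matrix S m"
    and "\<And>u v. u \<in> pwords S \<Longrightarrow> v \<in> pwords S \<Longrightarrow>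
      word_val W (\<lambda>s. s) u = word_val W (\<lambda>s. s) v \<longleftrightarrow> (u, v) \<in> pres_eq S (coxeter_rels S m)"
    and "\<And>a. a \<in> carrier W \<Longrightarrow> \<exists>w\<in>pwords S. word_val W (\<lambda>s. s) w = a"
proof -
  from assms obtain m \<phi> where W: "group W" "S \<subseteq> carrier W" and m: "coxeter_matrix S m"
    and \<phi>: "\<phi> \<in> iso (presented_group S (coxeter_rels S m)) W"
      "\<And>s. s \<in> S \<Longrightarrow> \<phi> (pgen S (coxeter_rels S m) s) = s"
    by (auto simp: coxeter_system_def)
  have hom: "\<phi> \<in> hom (presented_group S (coxeter_rels S m)) W"
    and bij: "bij_betw \<phi> (carrier (presented_group S (coxeter_rels S m))) (carrier W)"
    using \<phi>(1) by (auto simp: iso_def)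
  have eq: "\<phi> (pclass S (coxeter_rels S m) w) = word_val W (\<lambda>s. s) w" if "w \<in> pwords S" for w
  proof -
    have "\<phi> (pclass S (coxeter_rels S m) w) = word_val W (\<phi> \<circ> pgen S (coxeter_rels S m)) w"
      using word_val_hom[OF group_presented W(1) hom _ that, of "pgen S (coxeter_rels S m)"] that
      by (simp add: pclass_eq_word_val pgen_closed)
    also have "\<dots> = word_val W (\<lambda>s. s) w" by (rule word_val_cong[OF that]) (simp add: \<phi>(2))
    finally show ?thesis .
  qed
  show thesis
  proof (rule that[OF m])
    fix u v assume uv: "u \<in> pwords S" "v \<in> pwords S"
    then have "\<phi> (pclass S (coxeter_rels S m) u) = \<phi> (pclass S (coxeter_rels S m) v)
        \<longleftrightarrow> pclass S (coxeter_rels S m) u = pclass S (coxeter_rels S m) v"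
      using inj_on_eq_iff[OF bij_betw_imp_inj_on[OF bij]] by (simp add: carrier_presented)
    then show "word_val W (\<lambda>s. s) u = word_val W (\<lambda>s. s) v \<longleftrightarrow> (u, v) \<in> pres_eq S (coxeter_rels S m)"
      using uv by (simp add: eq pclass_eq_iff)
  next
    fix a assume "a \<in> carrier W"
    then obtain w where "w \<in> pwords S" "a = \<phi> (pclass S (coxeter_rels S m) w)"
      using bij_betw_imp_surj_on[OF bij] by (auto simp: carrier_presented)
    then show "\<exists>w\<in>pwords S. word_val W (\<lambda>s. s) w = a" using eq by auto
  qed
qed

lemma coxeter_generator_square:
  assumes "coxeter_system W S" "s \<in> S" shows "s \<otimes>\<^bsub>W\<^esub> s = \<one>\<^bsub>W\<^esub>"
proof -
  interpret group W using assms by (simp add: coxeter_system_def)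
  obtain m where m: "coxeter_matrix S m"
    and eq: "\<And>u v. u \<in> pwords S \<Longrightarrow> v \<in> pwords S \<Longrightarrow>
      word_val W (\<lambda>s. s) u = word_val W (\<lambda>s. s) v \<longleftrightarrow> (u, v) \<in> pres_eq S (coxeter_rels S m)"
    using coxeter_systemE[OF assms(1)] by metis
  have "m s s = 1" using m assms by (simp add: coxeter_matrix_def)
  then have "(pos_word [s, s], []) \<in> coxeter_rels S m"
    using assms unfolding coxeter_rels_def
    by (intro CollectI exI[of _ s]) (auto simp: alt_word_Suc numeral_2_eq_2)
  then have "([] @ pos_word [s, s] @ [], [] @ [] @ []) \<in> pres_eq S (coxeter_rels S m)"
    using assms by (intro pres_eq.rel) auto
  then have "word_val W (\<lambda>s. s) (pos_word [s, s]) = word_val W (\<lambda>s. s) []"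
    using assms by (subst eq) auto
  moreover have "s \<in> carrier W" using assms by (auto simp: coxeter_system_def)
  ultimately show ?thesis by simp
qed

lemma generators_subset_reflections:
  assumes "coxeter_system W S" shows "S \<subseteq> reflections W S"
proof
  fix s assume s: "s \<in> S"
  interpret group W using assms by (simp add: coxeter_system_def)
  have "s \<in> carrier W" using assms s by (auto simp: coxeter_system_def)
  then have "s = \<one>\<^bsub>W\<^esub> \<otimes>\<^bsub>W\<^esub> s \<otimes>\<^bsub>W\<^esub> inv\<^bsub>W\<^esub> \<one>\<^bsub>W\<^esub>" by simp
  then show "s \<in> reflections W S" using s unfolding reflections_def by blast
qed

lemma coxeter_involution_group:
  assumes "coxeter_system W S" shows "involution_group W (reflections W S)"
proof -
  interpret group W using assms by (simp add: coxeter_system_def)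
  have S: "S \<subseteq> carrier W" using assms by (simp add: coxeter_system_def)
  show ?thesis
  proof
    show "reflections W S \<subseteq> carrier W" using S by (auto simp: reflections_def)
    fix t assume "t \<in> reflections W S"
    then obtain g s where g: "g \<in> carrier W" "s \<in> S" "t = g \<otimes>\<^bsub>W\<^esub> s \<otimes>\<^bsub>W\<^esub> inv\<^bsub>W\<^esub> g"
      by (auto simp: reflections_def)
    then have s: "s \<in> carrier W" using S by auto
    have "s \<otimes>\<^bsub>W\<^esub> (s \<otimes>\<^bsub>W\<^esub> x) = x" if "x \<in> carrier W" for x
      using coxeter_generator_square[OF assms g(2)] s that by (simp flip: m_assoc)
    then show "t \<otimes>\<^bsub>W\<^esub> t = \<one>\<^bsub>W\<^esub>" using g s by (simp add: m_assoc inv_m_cancel)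
    fix h assume "h \<in> carrier W"
    then have "h \<otimes>\<^bsub>W\<^esub> t \<otimes>\<^bsub>W\<^esub> inv\<^bsub>W\<^esub> h = (h \<otimes>\<^bsub>W\<^esub> g) \<otimes>\<^bsub>W\<^esub> s \<otimes>\<^bsub>W\<^esub> inv\<^bsub>W\<^esub> (h \<otimes>\<^bsub>W\<^esub> g)"
      using g s by (simp add: m_assoc inv_mult_group)
    then show "h \<otimes>\<^bsub>W\<^esub> t \<otimes>\<^bsub>W\<^esub> inv\<^bsub>W\<^esub> h \<in> reflections W S"
      using g \<open>h \<in> carrier W\<close> unfolding reflections_def by blast
  next
    fix a assume "a \<in> carrier W"
    then obtain w where w: "w \<in> pwords S" "word_val W (\<lambda>s. s) w = a"
      using coxeter_systemE[OF assms] by metis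
    have inv: "inv\<^bsub>W\<^esub> s = s" if "s \<in> S" for s
      using coxeter_generator_square[OF assms that] that S by (auto intro: inv_equality)
    have "word_val W (\<lambda>s. s) w = gprod W (map fst w)"
      using w(1) by (induction w) (auto simp: inv)
    moreover have "set (map fst w) \<subseteq> reflections W S"
      using w(1) generators_subset_reflections[OF assms] by (auto simp: pwords_def)
    ultimately show "\<exists>xs. set xs \<subseteq> reflections W S \<and> gprod W xs = a"
      using w(2) by (intro exI[of _ "map fst w"]) simp
  qed
qed

text \<open>\<open>B\<close> collects one root per factor. The order of quantifiers matters:
  \<open>B\<close> is fixed before \<open>b\<close> and \<open>f\<close>, so the same few roots
  control the displacement of all points in all deformations.\<close>

lemma reflections_product_span:
  assumes "coxeter_system W S" "finite S" "set xs \<subseteq> reflections W S"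
  shows "\<exists>w\<in>pwords S. word_val W (\<lambda>s. s) w = gprod W xs \<and>
    (\<exists>B. finite B \<and> card B \<le> length xs \<and> (\<forall>b f. affine_act S m b w f - f \<in> fun_vs.span B))"
  using assms(3)
proof (induction xs)
  case Nil
  then show ?case by (intro bexI[of _ "[]"]) (auto intro!: exI[of _ "{}"] simp: zero_fun_def)
next
  case (Cons t xs)
  interpret group W using assms by (simp add: coxeter_system_def)
  have S: "(\<lambda>s. s) \<in> S \<rightarrow> carrier W" using assms by (auto simp: coxeter_system_def)
  obtain w B where w: "w \<in> pwords S" "word_val W (\<lambda>s. s) w = gprod W xs" and B: "finite B" "card B \<le> length xs"
    "\<And>b f. affine_act S m b w f - f \<in> fun_vs.span B"
    using Cons.IH[OF subset_trans[OF set_subset_Cons Cons.prems]] by blast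
  obtain g s where g: "g \<in> carrier W" "s \<in> S" "t = g \<otimes>\<^bsub>W\<^esub> s \<otimes>\<^bsub>W\<^esub> inv\<^bsub>W\<^esub> g"
    using Cons by (auto simp: reflections_def)
  obtain u where u: "u \<in> pwords S" "word_val W (\<lambda>s. s) u = g"
    using g coxeter_systemE[OF assms(1)] by metis
  define v where "v = u @ (s, False) # inv_word u"
  have v: "v \<in> pwords S" using u g by (simp add: v_def)
  have "word_val W (\<lambda>s. s) v = t"
    unfolding v_def using u g S
    by (subst word_val_append[OF S]) (auto simp: word_val_inv_word[OF S] m_assoc Pi_iff)
  then have "word_val W (\<lambda>s. s) (v @ w) = gprod W (t # xs)"
    using w v by (simp add: word_val_append[OF S])
  moreover define \<beta> where "\<beta> = affine_act S m (\<lambda>_. 0) u (delta s)"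
  have "affine_act S m b (v @ w) f - f \<in> fun_vs.span (insert \<beta> B)" for b f
  proof -
    have "affine_act S m b v (affine_act S m b w f) - affine_act S m b w f \<in> fun_vs.span {\<beta>}"
      unfolding v_def \<beta>_def by (rule affine_act_reflection[OF assms(2) u(1) g(2)])
    then have "affine_act S m b v (affine_act S m b w f) - affine_act S m b w f
        \<in> fun_vs.span (insert \<beta> B)"
      using fun_vs.span_mono[of "{\<beta>}" "insert \<beta> B"] by auto
    moreover have "affine_act S m b w f - f \<in> fun_vs.span (insert \<beta> B)"
      using B(3)[of b f] fun_vs.span_mono[of B "insert \<beta> B"] by auto
    ultimately have "(affine_act S m b v (affine_act S m b w f) - affine_act S m b w f)
       + (affine_act S m b w f - f) \<in> fun_vs.span (insert \<beta> B)"
      by (rule fun_vs.span_add)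
    then show ?thesis by simp
  qed
  moreover have "card (insert \<beta> B) \<le> length (t # xs)"
    using B(1,2) by (simp add: card_insert_if)
  moreover have "v @ w \<in> pwords S" "finite (insert \<beta> B)" using w(1) v B(1) by simp_all
  ultimately show ?case by blast
qed

text \<open>For each simple root some deformation moves the origin exactly by that root. As
  \<open>B\<close> does not vary with the deformation, it spans all these independent vectors, so a
  reduced factorization has at least as many factors as \<open>ss\<close>.\<close>

lemma coxeter_element_length:
  assumes W: "coxeter_system W S" "finite S" and ss: "distinct ss" "set ss \<subseteq> S"
  shows "gen_len W (reflections W S) (gprod W ss) = length ss"
proof -
  interpret involution_group W "reflections W S" by (rule coxeter_involution_group[OF W(1)])
  have sT: "set ss \<subseteq> reflections W S" using ss generators_subset_reflections[OF W(1)] by auto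
  obtain m where m: "coxeter_matrix S m"
    and eq: "\<And>u v. u \<in> pwords S \<Longrightarrow> v \<in> pwords S \<Longrightarrow>
      word_val W (\<lambda>s. s) u = word_val W (\<lambda>s. s) v \<longleftrightarrow> (u, v) \<in> pres_eq S (coxeter_rels S m)"
    using coxeter_systemE[OF W(1)] by metis
  obtain xs where xs: "xs \<in> red_words W (reflections W S) (gprod W ss)"
    using red_words_ex[OF gprod_T[OF sT]] .
  then obtain w B where w: "w \<in> pwords S" "word_val W (\<lambda>s. s) w = gprod W ss"
    and B: "finite B" "card B \<le> length xs" "\<And>b f. affine_act S m b w f - f \<in> fun_vs.span B"
    using reflections_product_span[OF W, of xs m] by (auto simp: red_words_iff)
  have "(w, pos_word ss) \<in> pres_eq S (coxeter_rels S m)"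
    using w ss by (subst eq[symmetric]) (auto simp: word_val_pos_word)
  then have act: "affine_act S m b w f = affine_act S m b (pos_word ss) f" for b f
    by (rule affine_act_pres_eq[OF W(2) m])
  have "delta s \<in> fun_vs.span B" if "s \<in> set ss" for s
  proof -
    obtain b where "affine_act S m b (pos_word ss) (\<lambda>_. 0) = (\<lambda>t. if t \<in> set ss then delta s t else 0)"
      using affine_act_coxeter_element[OF ss(1)] by blast
    also have "\<dots> = delta s" using that by (auto simp: delta_def)
    finally have "affine_act S m b w (\<lambda>_. 0) - (\<lambda>_. 0) = delta s" by (auto simp: act fun_eq_iff)
    then show ?thesis using B(3)[of b "\<lambda>_. 0"] by simp
  qed
  then have "card (delta ` set ss) \<le> card B"
    using fun_vs.independent_span_bound[OF B(1) independent_delta[of "set ss"]] by auto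
  then have "length ss \<le> length xs" using B(2) ss(1) by (simp add: card_delta distinct_card)
  then show ?thesis using gen_len_le[OF sT] xs by (auto simp: red_words_iff)
qed

text \<open>A trivial reflection would make a conjugate generator trivial, but one-letter tuples
  have length 1 by \<open>coxeter_element_length\<close>.\<close>

lemma one_notin_reflections:
  assumes "coxeter_system W S" "finite S" shows "\<one>\<^bsub>W\<^esub> \<notin> reflections W S"
proof
  interpret involution_group W "reflections W S" by (rule coxeter_involution_group[OF assms(1)])
  assume "\<one>\<^bsub>W\<^esub> \<in> reflections W S"
  then obtain g s where g: "g \<in> carrier W" "s \<in> S" "\<one>\<^bsub>W\<^esub> = g \<otimes>\<^bsub>W\<^esub> s \<otimes>\<^bsub>W\<^esub> inv\<^bsub>W\<^esub> g"
    by (auto simp: reflections_def)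
  have s: "s \<in> carrier W" using assms(1) g(2) by (auto simp: coxeter_system_def)
  have "s = inv\<^bsub>W\<^esub> g \<otimes>\<^bsub>W\<^esub> (g \<otimes>\<^bsub>W\<^esub> s \<otimes>\<^bsub>W\<^esub> inv\<^bsub>W\<^esub> g) \<otimes>\<^bsub>W\<^esub> g"
    using g(1) s by (simp add: m_assoc inv_m_cancel)
  then have "s = \<one>\<^bsub>W\<^esub>" using g(1) by (simp flip: g(3))
  then have "gprod W [s] = gprod W []" by simp
  then have "gen_len W (reflections W S) (gprod W [s]) \<le> 0"
    using gen_len_le[of "[]"] by simp
  then show False using coxeter_element_length[OF assms, of "[s]"] g by simp
qed

section \<open>From dual to classical presentations\<close>

lemma presented_rel:
  assumes "(l, r) \<in> R" "l \<in> pwords Y" "r \<in> pwords Y"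
  shows "word_val (presented_group Y R) (pgen Y R) l = word_val (presented_group Y R) (pgen Y R) r"
  using pres_eq.rel[OF assms, of "[]" "[]"] assms(2,3)
  by (simp flip: pclass_eq_word_val) (simp add: pclass_eq_iff)

lemma map_alt_word: "map f (alt_word r r' n) = alt_word (f r) (f r') n"
  by (simp add: alt_word_def o_def if_distrib)

lemma set_alt_word: "set (alt_word r r' n) \<subseteq> {r, r'}"
  by (auto simp: alt_word_def)

text \<open>The braid relation follows once the elements x k produced by repeated Hurwitz moves on
  the pair (a, b) return to b.\<close>

lemma (in group) alt_word_braid:
  assumes x: "\<And>k. x k \<in> carrier G" "x 0 = a" "\<And>k. x (Suc k) \<otimes> x k = a \<otimes> b"
    and b: "b \<in> carrier G" "x n = b"
  shows "gprod G (alt_word a b (Suc n)) = gprod G (alt_word b a (Suc n))"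
proof -
  have a: "a \<in> carrier G" using x by metis
  have cl: "gprod G (alt_word a b k) \<in> carrier G" for k
    using set_alt_word[of a b k] a b by (intro gprod_closed) auto
  \<comment> \<open>Two leading letters \<open>a b\<close> can be exchanged for
    \<open>x (Suc k)\<close> times \<open>x k\<close>, and by induction \<open>x k\<close> is
    absorbed into the alternating word behind it.\<close>
  have "gprod G (alt_word a b (Suc k)) = x k \<otimes> gprod G (alt_word a b k)" for k
  proof (induction k)
    case 0
    then show ?case using x by (simp add: alt_word_Suc)
  next
    case (Suc k)
    have "gprod G (alt_word a b (Suc (Suc k))) = (a \<otimes> b) \<otimes> gprod G (alt_word a b k)"
      using a b cl by (simp add: alt_word_Suc m_assoc)
    also have "\<dots> = x (Suc k) \<otimes> (x k \<otimes> gprod G (alt_word a b k))"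
      using m_assoc[OF x(1)[of "Suc k"] x(1)[of k] cl[of k]] x(3) by simp
    finally show ?case using Suc by simp
  qed
  from this[of n] show ?thesis using b by (simp add: alt_word_Suc)
qed

text \<open>Inverse braid generators carry \<open>b\<close> leftwards unchanged and conjugate what
  it passes. This makes two distant simple reflections adjacent, so that their product lies below
  the Coxeter element.\<close>

lemma hurwitz_steps_to_front: "\<exists>q'. (hurwitz_step G)\<^sup>*\<^sup>* (q @ [b]) (b # q')"
proof (induction q)
  case (Cons a q)
  then obtain q' where "(hurwitz_step G)\<^sup>*\<^sup>* (q @ [b]) (b # q')" by blast
  from hurwitz_steps_context[OF this, of "[a]" "[]"]
  have "(hurwitz_step G)\<^sup>*\<^sup>* ((a # q) @ [b]) ([] @ a # b # q')" by simp
  moreover have "hurwitz_step G ([] @ a # b # q') ([] @ b # (inv\<^bsub>G\<^esub> b \<otimes>\<^bsub>G\<^esub> a \<otimes>\<^bsub>G\<^esub> b) # q')"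
    unfolding hurwitz_step_iff by blast
  ultimately have "(hurwitz_step G)\<^sup>*\<^sup>* ((a # q) @ [b]) ([] @ b # (inv\<^bsub>G\<^esub> b \<otimes>\<^bsub>G\<^esub> a \<otimes>\<^bsub>G\<^esub> b) # q')"
    by (rule rtranclp.rtrancl_into_rtrancl)
  then show ?case by auto
qed auto

context involution_group begin

text \<open>The reflections (a b)^k a of the dihedral group of \<open>a\<close> and
  \<open>b\<close>. The recursion is chosen so that consecutive members always multiply to
  \<open>a b\<close>, giving a chain of factorizations of one element.\<close>

primrec dihedral_seq :: "'a \<Rightarrow> 'a \<Rightarrow> nat \<Rightarrow> 'a" where
  "dihedral_seq a b 0 = a"
| "dihedral_seq a b (Suc k) = a \<otimes> b \<otimes> inv (dihedral_seq a b k)"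

context
  fixes a b assumes a: "a \<in> T" and b: "b \<in> T"
begin

lemma dihedral_seq_T: "dihedral_seq a b k \<in> T"
proof -
  \<comment> \<open>Two consecutive members are carried along because member k+2 is the conjugate of
    member k by \<open>a b\<close>.\<close>
  have "dihedral_seq a b k \<in> T \<and> dihedral_seq a b (Suc k) \<in> T"
  proof (induction k)
    case 0
    then show ?case using a b T_conj[of b a] T_closed by simp
  next
    case (Suc k)
    let ?y = "dihedral_seq a b k"
    have "dihedral_seq a b (Suc (Suc k)) = (a \<otimes> b) \<otimes> ?y \<otimes> inv (a \<otimes> b)"
      using Suc a b T_closed by (simp add: inv_mult_group m_assoc)
    also have "\<dots> \<in> T" using Suc a b T_closed T_conj[of ?y "a \<otimes> b"] by blast
    finally show ?case using Suc by blast
  qed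
  then show ?thesis by blast
qed

lemma dihedral_seq_mult: "dihedral_seq a b (Suc k) \<otimes> dihedral_seq a b k = a \<otimes> b"
  using dihedral_seq_T[of k] a b T_closed by (simp add: m_assoc)

lemma dihedral_seq_pow: "dihedral_seq a b k = (a \<otimes> b) [^] k \<otimes> a"
proof (induction k)
  case (Suc k)
  have "dihedral_seq a b (Suc k) = (a \<otimes> b) \<otimes> ((a \<otimes> b) [^] k \<otimes> a)"
    using Suc dihedral_seq_T[of k] T_inv by simp
  also have "\<dots> = (a \<otimes> b) [^] Suc k \<otimes> a"
    using a b T_closed nat_pow_Suc2[of "a \<otimes> b" k] by (simp flip: m_assoc)
  finally show ?case .
qed (use a T_closed in simp)

text \<open>If \<open>a b\<close> has order n+1, its n-th power is its inverse \<open>b a\<close>,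
  and multiplying by \<open>a\<close> leaves \<open>b\<close>. Thus the chain reaches
  \<open>b\<close> just when the braid relation needs it.\<close>

lemma dihedral_seq_ord:
  assumes "ord (a \<otimes> b) = Suc n" shows "dihedral_seq a b n = b"
proof -
  have ab: "a \<in> carrier G" "b \<in> carrier G" using a b T_closed by auto
  then have "(a \<otimes> b) [^] n \<otimes> (a \<otimes> b) = \<one>"
    using pow_ord_eq_1[of "a \<otimes> b"] assms by simp
  then have "(a \<otimes> b) [^] n = inv (a \<otimes> b)"
    using ab by (intro inv_equality[symmetric]) auto
  also have "\<dots> = b \<otimes> a" using ab a b by (simp add: inv_mult_group T_inv)
  finally show ?thesis
    using ab T_square[OF a] by (simp add: dihedral_seq_pow m_assoc)
qed

end

text \<open>Supplies the canonical homomorphism from the Artin group back to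
  \<open>G\<close>.\<close>

lemma art_rels_hold:
  assumes "set rs \<subseteq> T" "(l, r) \<in> art_rels G (set rs)"
  shows "word_val G (\<lambda>s. s) l = word_val G (\<lambda>s. s) r"
proof -
  obtain a b where *: "l = pos_word (alt_word a b (cox_m G a b))"
    "r = pos_word (alt_word b a (cox_m G a b))" "a \<in> T" "b \<in> T" "cox_m G a b \<noteq> 0"
    using assms by (auto simp: art_rels_def)
  then obtain n where n: "cox_m G a b = Suc n" by (cases "cox_m G a b") auto
  then have "gprod G (alt_word a b (Suc n)) = gprod G (alt_word b a (Suc n))"
    using * dihedral_seq_T[of a b] dihedral_seq_mult[of a b] dihedral_seq_ord[of a b n] T_closed
    by (intro alt_word_braid[of "dihedral_seq a b"]) (auto simp: cox_m_def simp del: dihedral_seq.simps(2))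
  then show ?thesis using * n by (simp add: word_val_pos_word)
qed

end

text \<open>Collects what the comparison of the two presentations uses, for any involution group, so
  that it can be applied to the product with the concatenated tuple.\<close>

locale dual_coxeter = involution_group +
  fixes rs :: "'a list"
  assumes one_notin_T: "\<one> \<notin> T"
    and rs_T: "set rs \<subseteq> T"
    and rs_len: "gen_len G T (gprod G rs) = length rs"
    and well_stab: "well_stabilized G rs"
    and pan_trans: "pan_transitive G T (gprod G rs)"
begin

abbreviation "c \<equiv> gprod G rs"
abbreviation "Art \<equiv> art_group G (set rs)"
abbreviation "ag \<equiv> art_gen G (set rs)"
abbreviation "Simples \<equiv> T \<inter> gen_interval G T c"
abbreviation "Dual \<equiv> art_star G T c"
abbreviation "dg \<equiv> pgen Simples (art_star_rels G T c)"

lemma rs_carrier: "set rs \<subseteq> carrier G" using rs_T T_carrier by blast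

lemma c_closed: "c \<in> carrier G" using rs_carrier by simp

lemma rs_red: "rs \<in> red_words G T c" using rs_T rs_len by (simp add: red_words_iff)

lemma c_interval: "c \<in> gen_interval G T c"
  using gen_len_le[of "[]"] c_closed by (simp add: interval_iff)

lemma group_Art: "group Art" unfolding art_group_def by (rule group_presented)
lemma group_Dual: "group Dual" unfolding art_star_def by (rule group_presented)

sublocale Art: group Art by (rule group_Art)
sublocale Dual: group Dual by (rule group_Dual)

lemma ag_closed: "r \<in> set rs \<Longrightarrow> ag r \<in> carrier Art"
  by (simp add: art_group_def art_gen_def pgen_closed)

lemma ars_carrier: "set (map ag rs) \<subseteq> carrier Art" using ag_closed by auto

lemma dg_closed: "t \<in> Simples \<Longrightarrow> dg t \<in> carrier Dual"
  unfolding art_star_def by (rule pgen_closed)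

section \<open>Consequences of the dual braid relations\<close>

lemma red_Simples: "u \<in> red_words G T c \<Longrightarrow> set u \<subseteq> Simples"
proof
  fix t assume u: "u \<in> red_words G T c" and "t \<in> set u"
  then obtain p q where "u = p @ [t] @ q" using split_list[of t u] by auto
  then have "gprod G [t] \<in> gen_interval G T c" using u red_words_infix(2) by blast
  moreover have "t \<in> T" using u \<open>t \<in> set u\<close> by (auto simp: red_words_iff)
  ultimately show "t \<in> Simples" using T_closed by simp
qed

lemma red_below_Simples:
  assumes "a \<in> gen_interval G T c" "u \<in> red_words G T a" shows "set u \<subseteq> Simples"
proof -
  have "inv a \<otimes> c \<in> carrier G" using assms(1) c_closed by (simp add: interval_iff)
  then obtain x where "x \<in> red_words G T (inv a \<otimes> c)" by (rule red_words_ex)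
  then have "u @ x \<in> red_words G T c" using red_words_complete assms c_closed by blast
  from red_Simples[OF this] show ?thesis by simp
qed

lemma Dual_rel:
  assumes "a \<in> gen_interval G T c" "u \<in> red_words G T a" "v \<in> red_words G T a"
  shows "gprod Dual (map dg u) = gprod Dual (map dg v)"
proof -
  have "(pos_word u, pos_word v) \<in> art_star_rels G T c" using assms by (auto simp: art_star_rels_def)
  then show ?thesis
    using presented_rel[of "pos_word u" "pos_word v" "art_star_rels G T c" Simples]
      red_below_Simples[OF assms(1)] assms(2,3)
    by (simp add: word_val_pos_word art_star_def)
qed

text \<open>Adjacent factors of a reduced word form a reduced pair below \<open>c\<close>. Any other
  pair of reflections with the same product has the same length, so the two pairs are identified by
  a dual relation.\<close>

lemma Dual_pair:
  assumes "p @ [a, b] @ q \<in> red_words G T c" "x \<in> T" "y \<in> T" "x \<otimes> y = a \<otimes> b"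
  shows "dg x \<otimes>\<^bsub>Dual\<^esub> dg y = dg a \<otimes>\<^bsub>Dual\<^esub> dg b" "x \<in> Simples" "y \<in> Simples"
proof -
  note ab = red_words_infix[OF assms(1)]
  have "set [a, b] \<subseteq> Simples" using red_below_Simples[OF ab(2,1)] .
  then have abT: "a \<in> Simples" "b \<in> Simples" by auto
  have "[x, y] \<in> red_words G T (gprod G [a, b])"
    using ab(1) assms(2-4) T_closed abT by (simp add: red_words_iff)
  note xy = ab(2) this
  have "set [x, y] \<subseteq> Simples" using red_below_Simples[OF xy] .
  then show *: "x \<in> Simples" "y \<in> Simples" by auto
  show "dg x \<otimes>\<^bsub>Dual\<^esub> dg y = dg a \<otimes>\<^bsub>Dual\<^esub> dg b"
    using Dual_rel[OF xy ab(1)] * abT dg_closed by simp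
qed

text \<open>Once \<open>a\<close> and \<open>b\<close> stand next to each other in a reduced
  factorization of \<open>c\<close>, every consecutive pair of the dihedral chain is a dual
  factorization of \<open>a b\<close>. The chain therefore survives in the dual group, where
  \<open>alt_word_braid\<close> applies.\<close>

lemma Dual_braid:
  assumes "a \<in> set rs" "b \<in> set rs" "ord (a \<otimes> b) = Suc n"
  shows "gprod Dual (alt_word (dg a) (dg b) (Suc n)) = gprod Dual (alt_word (dg b) (dg a) (Suc n))"
proof -
  have *: "gprod Dual (alt_word (dg a) (dg b) (Suc n)) = gprod Dual (alt_word (dg b) (dg a) (Suc n))"
    if rs: "rs = p @ a # q @ b # s" and ord: "ord (a \<otimes> b) = Suc n" for a b p q s
  proof -
    obtain q' where "(hurwitz_step G)\<^sup>*\<^sup>* (q @ [b]) (b # q')" using hurwitz_steps_to_front[of G q b] by blast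
    from hurwitz_steps_context[OF this, of "p @ [a]" s]
    have red: "p @ [a, b] @ (q' @ s) \<in> red_words G T c"
      using hurwitz_steps_red_words[OF _ rs_red] rs by simp
    have ab: "a \<in> T" "b \<in> T" using rs rs_T by auto
    let ?x = "dihedral_seq a b"
    have pair: "dg (?x (Suc k)) \<otimes>\<^bsub>Dual\<^esub> dg (?x k) = dg a \<otimes>\<^bsub>Dual\<^esub> dg b"
      "?x k \<in> Simples" for k
      using Dual_pair[OF red dihedral_seq_T[OF ab, of "Suc k"] dihedral_seq_T[OF ab, of k]
        dihedral_seq_mult[OF ab, of k]] by blast+
    have "b \<in> Simples" using red_Simples[OF rs_red] rs by auto
    then show ?thesis
      using pair dg_closed dihedral_seq_ord[OF ab ord]
      by (intro Dual.alt_word_braid[of "\<lambda>k. dg (?x k)"]) (auto simp del: dihedral_seq.simps(2))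
  qed
  show ?thesis
  proof (cases "a = b")
    case False
    obtain p s where rs: "rs = p @ a # s" using split_list[OF assms(1)] by blast
    then consider "b \<in> set p" | "b \<in> set s" using False assms(2) by auto
    then show ?thesis
    proof cases
      case 1
      then obtain p' q where "rs = p' @ b # q @ a # s" using split_list[OF 1] rs by auto
      \<comment> \<open>The argument above expects the generator that occurs first in
        \<open>rs\<close> as its first argument; \<open>b a\<close> is the inverse of
        \<open>a b\<close>, so exchanging the two keeps the order.\<close>
      moreover have "ord (b \<otimes> a) = ord (inv (a \<otimes> b))"
        using assms rs_T T_closed T_inv by (simp add: inv_mult_group subset_iff)
      then have "ord (b \<otimes> a) = Suc n"
        using assms rs_carrier by (simp add: ord_inv subset_iff)
      ultimately show ?thesis using * by metis
    next
      case 2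
      then obtain q s' where "rs = p @ a # q @ b # s'" using split_list[OF 2] rs by auto
      then show ?thesis using * assms(3) by blast
    qed
  qed simp
qed

section \<open>Lifting reduced factorizations to the Artin group\<close>

definition lifts :: "'a list \<Rightarrow> ('a \<times> bool) list set list \<Rightarrow> bool" where
  "lifts u U \<longleftrightarrow> (\<exists>w\<in>pwords (bgens (length rs)).
     u = hurwitz_word G w rs \<and> U = hurwitz_word Art w (map ag rs))"

lemma lifts_base: "lifts rs (map ag rs)"
  unfolding lifts_def by (intro bexI[of _ "[]"]) auto

lemma lifts_gen:
  assumes "lifts u U" "fst x \<in> bgens (length rs)"
  shows "lifts (hurwitz_gen G x u) (hurwitz_gen Art x U)"
proof -
  obtain w where "w \<in> pwords (bgens (length rs))"
     "u = hurwitz_word G w rs" "U = hurwitz_word Art w (map ag rs)"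
    using assms by (auto simp: lifts_def)
  then show ?thesis unfolding lifts_def using assms(2) by (intro bexI[of _ "x # w"]) auto
qed

lemma lifts_length:
  assumes "lifts u U" shows "length u = length rs" "length U = length rs"
  using assms by (auto simp: lifts_def)

lemma lifts_red:
  assumes "lifts u U" shows "u \<in> red_words G T c"
  using assms hurwitz_orbit_iff[of rs G u] hurwitz_steps_red_words[OF _ rs_red] by (auto simp: lifts_def)

lemma lifts_Art:
  assumes "lifts u U" shows "set U \<subseteq> carrier Art" "gprod Art U = gprod Art (map ag rs)"
  using assms Art.hurwitz_word_carrier[OF _ ars_carrier] Art.gprod_hurwitz_word[OF _ ars_carrier]
  by (auto simp: lifts_def simp del: map_map)

lemma lifts_ex: "u \<in> red_words G T c \<Longrightarrow> \<exists>U. lifts u U"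
  using pan_trans c_interval rs_red
  by (fastforce simp: pan_transitive_iff hurwitz_orbit_iff[symmetric] lifts_def)

text \<open>Two braids carrying \<open>rs\<close> to the same tuple differ by a stabilizing braid,
  which by well-stabilizedness also fixes the Artin generators. With \<open>lifts_ex\<close> the
  relation becomes a function on reduced factorizations of \<open>c\<close>.\<close>

lemma lifts_unique:
  assumes "lifts u U" "lifts u U'" shows "U = U'"
proof -
  obtain w w' where w: "w \<in> pwords (bgens (length rs))" "u = hurwitz_word G w rs"
      "U = hurwitz_word Art w (map ag rs)"
    and w': "w' \<in> pwords (bgens (length rs))" "u = hurwitz_word G w' rs"
      "U' = hurwitz_word Art w' (map ag rs)"
    using assms by (auto simp: lifts_def)
  let ?v = "inv_word w' @ w"
  have inv: "(inv_word w' @ w', []) \<in> pres_eq (bgens (length rs)) (braid_rels (length rs))"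
    "(w' @ inv_word w', []) \<in> pres_eq (bgens (length rs)) (braid_rels (length rs))"
    using pres_eq_inv_word[of "inv_word w'"] pres_eq_inv_word[of w'] w'(1) by auto
  have "hurwitz_word G ?v rs = hurwitz_word G (inv_word w' @ w') rs"
    using w w' by (simp add: hurwitz_word_append)
  also have "\<dots> = rs" using hurwitz_word_pres_eq[OF inv(1) _ rs_carrier] by simp
  finally have "hurwitz_word Art ?v (map ag rs) = map ag rs"
    using well_stab w(1) w'(1) by (simp add: well_stabilized_iff[OF is_group rs_carrier])
  then have "hurwitz_word Art w' (hurwitz_word Art (inv_word w') U) = U'"
    using w w' by (simp add: hurwitz_word_append)
  moreover have "hurwitz_word Art (w' @ inv_word w') U = U"
    using Art.hurwitz_word_pres_eq[OF inv(2) _ lifts_Art(1)] assms(1) lifts_length by simp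
  ultimately show ?thesis by (simp add: hurwitz_word_append)
qed

text \<open>The two tails factor the same element below \<open>c\<close>, so transitivity for that
  element joins them by moves that avoid the first entry. The lifted moves leave \<open>g\<close> in
  place, and uniqueness of the lift of \<open>t # u'\<close> gives \<open>g = g'\<close>.
  Transitivity at \<open>c\<close> alone would not suffice for this argument.\<close>

lemma lifts_head_unique:
  assumes "lifts (t # u) (g # U)" "lifts (t # u') (g' # U')" shows "g = g'"
proof -
  note red = lifts_red[OF assms(1)] lifts_red[OF assms(2)]
  have t: "t \<in> T" "set u \<subseteq> T" "set u' \<subseteq> T" using red by (auto simp: red_words_iff)
  have uu: "u \<in> red_words G T (gprod G u)" "gprod G u \<in> gen_interval G T c"
    "u' \<in> red_words G T (gprod G u')"
    using red_words_infix[of "[t]" u "[]" c] red_words_infix[of "[t]" u' "[]" c] red by auto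
  have "t \<otimes> gprod G u = t \<otimes> gprod G u'" using red by (simp add: red_words_iff)
  then have "gprod G u' = gprod G u" using t T_closed gprod_T by simp
  then have "(hurwitz_step G)\<^sup>*\<^sup>* u u'"
    using pan_trans uu by (auto simp: pan_transitive_iff)
  then have "\<exists>U'. lifts (t # u') (g # U')"
  proof (induction rule: rtranclp_induct)
    case base
    then show ?case using assms by blast
  next
    case (step y z)
    then obtain Y x where Y: "lifts (t # y) (g # Y)" and
      x: "fst x \<in> bgens (length y)" "z = hurwitz_gen G x y"
      by (auto simp: hurwitz_step_def)
    \<comment> \<open>Placing an entry in front raises the index of every braid generator by
      one.\<close>
    have shift: "hurwitz_gen H (Suc (fst x), snd x) (h # ys) = h # hurwitz_gen H x ys" for h ys and H :: "('x, 'y) monoid_scheme"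
      by (simp add: hurwitz_gen_def Let_def)
    have "Suc (fst x) \<in> bgens (length rs)" using x(1) lifts_length(1)[OF Y] by auto
    from lifts_gen[OF Y, of "(Suc (fst x), snd x)"] this
    show ?case using x(2) by (auto simp: shift)
  qed
  then show ?thesis using lifts_unique[OF assms(2)] by blast
qed

text \<open>An inverse generator sends (a, t) to (t, t^-1 a t), so \<open>t\<close> and its lift
  travel to the front unchanged and in parallel. Every position is thereby reduced to the
  first.\<close>

lemma lifts_move_front:
  assumes "lifts (p @ t # q) (P @ g # Q)" "length P = length p"
  shows "\<exists>u U. lifts (t # u) (g # U)"
  using assms
proof (induction p arbitrary: q P Q rule: rev_induct)
  case (snoc a p)
  then obtain P' h where P: "P = P' @ [h]" "length P' = length p" by (cases P rule: rev_cases) auto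
  have L: "lifts (p @ a # t # q) (P' @ h # g # Q)" using snoc.prems P by simp
  have "length p \<in> bgens (length rs)" using lifts_length(1)[OF L] by auto
  then have "lifts (hurwitz_gen G (length p, True) (p @ a # t # q))
      (hurwitz_gen Art (length p, True) (P' @ h # g # Q))"
    using lifts_gen[OF L, of "(length p, True)"] by simp
  then show ?case
    using snoc.IH P(2) hurwitz_gen_split(2)[of Art P' h g Q] by (simp add: P(2))
qed auto

text \<open>The choice is determined on \<open>Simples\<close>: each such element heads a reduced
  factorization of \<open>c\<close>, and \<open>lifts_head_unique\<close> fixes the first lifted
  entry.\<close>

definition lift :: "'a \<Rightarrow> ('a \<times> bool) list set" where
  "lift t = (SOME g. \<exists>u U. lifts (t # u) (g # U))"

lemma lift_eq: "lifts (t # u) (g # U) \<Longrightarrow> lift t = g"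
  unfolding lift_def using lifts_head_unique by (intro some_equality) blast+

lemma lifts_eq_map:
  assumes "lifts u U" shows "U = map lift u"
proof (rule nth_equalityI)
  show len: "length U = length (map lift u)" using lifts_length[OF assms] by simp
  fix i assume i: "i < length U"
  have "lifts (take i u @ u ! i # drop (Suc i) u) (take i U @ U ! i # drop (Suc i) U)"
    using assms i len by (simp flip: id_take_nth_drop)
  then have "\<exists>v V. lifts (u ! i # v) (U ! i # V)"
    by (rule lifts_move_front) (use i len in auto)
  then show "U ! i = map lift u ! i" using lift_eq i len by force
qed

lemma singleton_red: "t \<in> T \<Longrightarrow> [t] \<in> red_words G T t"
proof -
  assume t: "t \<in> T"
  have "gen_len G T t \<noteq> 0"
  proof
    assume "gen_len G T t = 0"
    moreover obtain xs where "xs \<in> red_words G T t" using red_words_ex[OF T_closed[OF t]] .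
    ultimately show False using one_notin_T t by (auto simp: red_words_iff)
  qed
  then show ?thesis using gen_len_le[of "[t]"] t T_closed by (simp add: red_words_iff)
qed

lemma lifts_map:
  assumes "u \<in> red_words G T c"
  shows "set (map lift u) \<subseteq> carrier Art" "gprod Art (map lift u) = gprod Art (map ag rs)"
proof -
  obtain U where "lifts u U" using lifts_ex[OF assms] by blast
  then show "set (map lift u) \<subseteq> carrier Art" "gprod Art (map lift u) = gprod Art (map ag rs)"
    using lifts_Art lifts_eq_map by metis+
qed

lemma Simples_red_ex: "t \<in> Simples \<Longrightarrow> \<exists>u. t # u \<in> red_words G T c"
proof -
  assume t: "t \<in> Simples"
  then have "inv t \<otimes> c \<in> carrier G" using T_closed c_closed by simp
  then obtain x where "x \<in> red_words G T (inv t \<otimes> c)" by (rule red_words_ex)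
  then have "[t] @ x \<in> red_words G T c" using t singleton_red red_words_complete c_closed by blast
  then show ?thesis by auto
qed

lemma lift_closed: "t \<in> Simples \<Longrightarrow> lift t \<in> carrier Art"
  using Simples_red_ex[of t] lifts_map(1) by force

text \<open>Complete both words by the same \<open>x\<close> to factorizations of \<open>c\<close>.
  Their lifts have the same product, since Hurwitz moves preserve products, and the lift of
  \<open>x\<close> cancels.\<close>

lemma lift_rels:
  assumes "a \<in> gen_interval G T c" "u \<in> red_words G T a" "v \<in> red_words G T a"
  shows "gprod Art (map lift u) = gprod Art (map lift v)"
proof -
  have "inv a \<otimes> c \<in> carrier G" using assms(1) c_closed by (simp add: interval_iff)
  then obtain x where "x \<in> red_words G T (inv a \<otimes> c)" by (rule red_words_ex)
  then have red: "u @ x \<in> red_words G T c" "v @ x \<in> red_words G T c"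
    using red_words_complete assms c_closed by blast+
  have "gprod Art (map lift (u @ x)) = gprod Art (map lift (v @ x))"
    using lifts_map(2)[OF red(1)] lifts_map(2)[OF red(2)] by simp
  moreover have "set (map lift u) \<subseteq> carrier Art" "set (map lift v) \<subseteq> carrier Art"
    "set (map lift x) \<subseteq> carrier Art" using lifts_map(1)[OF red(1)] lifts_map(1)[OF red(2)] by auto
  ultimately show ?thesis
    by (simp add: Art.gprod_append Art.r_cancel del: set_map)
qed

text \<open>The dual relations say that the generator of a b a^-1 times that of \<open>a\<close>
  equals that of \<open>a\<close> times that of \<open>b\<close>. Thus conjugation of neighbours in
  the dual group is again a generator and mirrors the move in \<open>G\<close>.\<close>

lemma Dual_hurwitz:
  assumes "u \<in> red_words G T c" "fst x \<in> bgens (length u)"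
  shows "hurwitz_gen Dual x (map dg u) = map dg (hurwitz_gen G x u)"
  using assms(2)
proof (cases rule: hurwitz_gen_cases[where G = G])
  case (1 p a b q)
  have ab: "a \<in> T" "b \<in> T" using 1 assms by (auto simp: red_words_iff)
  have red: "p @ [a, b] @ q \<in> red_words G T c" using assms 1 by simp
  have S: "a \<in> Simples" "b \<in> Simples" using red_Simples[OF red] by auto
  have "a \<otimes> b \<otimes> inv a \<in> T" using ab T_conj T_closed by blast
  moreover have "(a \<otimes> b \<otimes> inv a) \<otimes> a = a \<otimes> b" using ab T_closed by (simp add: m_assoc)
  ultimately have d: "dg (a \<otimes> b \<otimes> inv a) \<otimes>\<^bsub>Dual\<^esub> dg a = dg a \<otimes>\<^bsub>Dual\<^esub> dg b" "a \<otimes> b \<otimes> inv a \<in> Simples"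
    using Dual_pair[OF red _ ab(1)] by blast+
  then have "dg a \<otimes>\<^bsub>Dual\<^esub> dg b \<otimes>\<^bsub>Dual\<^esub> inv\<^bsub>Dual\<^esub> dg a = dg (a \<otimes> b \<otimes> inv a)"
    using S dg_closed by (simp add: Dual.inv_solve_right')
  then show ?thesis using 1 hurwitz_gen_split(1)[of Dual "map dg p" "dg a" "dg b" "map dg q"] by simp
next
  case (2 p a b q)
  have ab: "a \<in> T" "b \<in> T" using 2 assms by (auto simp: red_words_iff)
  have red: "p @ [a, b] @ q \<in> red_words G T c" using assms 2 by simp
  have S: "a \<in> Simples" "b \<in> Simples" using red_Simples[OF red] by auto
  have "inv b \<otimes> a \<otimes> b \<in> T" using ab T_conj[of a "inv b"] T_closed by simp
  moreover have "b \<otimes> (inv b \<otimes> a \<otimes> b) = a \<otimes> b" using ab T_closed by (simp add: m_assoc inv_m_cancel)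
  ultimately have d: "dg b \<otimes>\<^bsub>Dual\<^esub> dg (inv b \<otimes> a \<otimes> b) = dg a \<otimes>\<^bsub>Dual\<^esub> dg b" "inv b \<otimes> a \<otimes> b \<in> Simples"
    using Dual_pair[OF red ab(2)] by blast+
  have "inv\<^bsub>Dual\<^esub> dg b \<otimes>\<^bsub>Dual\<^esub> dg a \<otimes>\<^bsub>Dual\<^esub> dg b = inv\<^bsub>Dual\<^esub> dg b \<otimes>\<^bsub>Dual\<^esub> (dg a \<otimes>\<^bsub>Dual\<^esub> dg b)"
    using S dg_closed by (simp add: Dual.m_assoc)
  also have "\<dots> = dg (inv b \<otimes> a \<otimes> b)"
    using S d(2) dg_closed by (simp flip: d(1) add: Dual.inv_m_cancel)
  finally show ?thesis using 2 hurwitz_gen_split(2)[of Dual "map dg p" "dg a" "dg b" "map dg q"] by simp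
qed

text \<open>Shows that sending a reflection to its lift and then to the dual group returns its dual
  generator, entry by entry along a braid word.\<close>

lemma lifts_Dual:
  assumes h: "h \<in> hom Art Dual" "\<And>r. r \<in> set rs \<Longrightarrow> h (ag r) = dg r" and "lifts u U"
  shows "map h U = map dg u"
proof -
  obtain w where "w \<in> pwords (bgens (length rs))"
     "u = hurwitz_word G w rs" "U = hurwitz_word Art w (map ag rs)"
    using assms(3) by (auto simp: lifts_def)
  then show ?thesis
  proof (induction w arbitrary: u U)
    case Nil
    then show ?case using h(2) by simp
  next
    case (Cons x w)
    let ?v = "hurwitz_word G w rs" and ?V = "hurwitz_word Art w (map ag rs)"
    have w: "w \<in> pwords (bgens (length rs))" "fst x \<in> bgens (length rs)" using Cons.prems by auto
    then have L: "lifts ?v ?V" by (auto simp: lifts_def)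
    have "map h U = hurwitz_gen Dual x (map h ?V)"
      using hurwitz_gen_hom[OF group_Art group_Dual h(1) lifts_Art(1)[OF L], of x] Cons.prems(3) w by simp
    also have "\<dots> = hurwitz_gen Dual x (map dg ?v)" using Cons.IH w by simp
    also have "\<dots> = map dg u" using Dual_hurwitz[OF lifts_red[OF L], of x] w Cons.prems(2) by simp
    finally show ?case .
  qed
qed

theorem art_group_iso_art_star: "Art \<cong> Dual"
proof -
  define R where "R = art_rels G (set rs)"
  define Q where "Q = art_star_rels G T c"
  have Art: "Art = presented_group (set rs) R" and Dual: "Dual = presented_group Simples Q"
    by (simp_all add: art_group_def art_star_def R_def Q_def)
  have ag: "ag = pgen (set rs) R" by (auto simp: art_gen_def R_def)
  have rs: "set rs \<subseteq> Simples" by (rule red_Simples[OF rs_red])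
  have dgc: "dg \<in> set rs \<rightarrow> carrier Dual" using rs dg_closed by auto
  have relD: "word_val Dual dg l = word_val Dual dg r" if lr: "(l, r) \<in> R" for l r
  proof -
    obtain a b where *: "l = pos_word (alt_word a b (cox_m G a b))"
      "r = pos_word (alt_word b a (cox_m G a b))" "a \<in> set rs" "b \<in> set rs" "cox_m G a b \<noteq> 0"
      using lr by (auto simp: R_def art_rels_def)
    then obtain n where "cox_m G a b = Suc n" by (cases "cox_m G a b") auto
    then show ?thesis
      using * Dual_braid[of a b n] by (simp add: word_val_pos_word map_alt_word cox_m_def)
  qed
  have lc: "lift \<in> Simples \<rightarrow> carrier Art" using lift_closed by auto
  have relA: "word_val Art lift l = word_val Art lift r" if lr: "(l, r) \<in> Q" for l r
  proof -
    obtain a u v where "l = pos_word u" "r = pos_word v" "a \<in> gen_interval G T c"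
      "u \<in> red_words G T a" "v \<in> red_words G T a"
      using lr unfolding Q_def art_star_rels_def by blast
    then show ?thesis using lift_rels[of a u v] by (simp only: word_val_pos_word)
  qed
  let ?h = "pres_lift Dual dg" and ?k = "pres_lift Art lift"
  have h: "?h \<in> hom Art Dual" "\<And>r. r \<in> set rs \<Longrightarrow> ?h (ag r) = dg r"
    using pres_lift_hom[OF group_Dual dgc relD] pres_lift_pgen[OF group_Dual dgc relD]
    by (simp_all add: Art ag)
  have k: "?k \<in> hom Dual Art" "\<And>t. t \<in> Simples \<Longrightarrow> ?k (dg t) = lift t"
    using pres_lift_hom[OF group_Art lc relA] pres_lift_pgen[OF group_Art lc relA]
    by (simp_all add: Dual Q_def)
  \<comment> \<open>The base pair is itself a lifted pair, so the lift of a simple reflection is its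
    Artin generator.\<close>
  have "map ag rs = map lift rs" by (rule lifts_eq_map[OF lifts_base])
  then have "?k (?h (ag r)) = ag r" if "r \<in> set rs" for r
    using that rs k(2)[of r] h(2)[of r] by (simp add: subset_iff)
  moreover have "?h (?k (dg t)) = dg t" if t: "t \<in> Simples" for t
  proof -
    obtain u where "t # u \<in> red_words G T c" using Simples_red_ex[OF t] by blast
    then obtain U where L: "lifts (t # u) U" using lifts_ex by blast
    show ?thesis using lifts_Dual[OF h L] lifts_eq_map[OF L] k(2)[OF t] by simp
  qed
  ultimately show ?thesis
    using presented_iso[of ?h "set rs" R Simples Q ?k] h(1) k(1) by (simp add: Art Dual ag Q_def)
qed

end

section \<open>Direct products and pan-transitivity\<close>

lemma hurwitz_steps_commute:
  assumes "\<And>a. a \<in> set xs \<Longrightarrow> y \<otimes>\<^bsub>G\<^esub> a \<otimes>\<^bsub>G\<^esub> inv\<^bsub>G\<^esub> y = a"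
  shows "(hurwitz_step G)\<^sup>*\<^sup>* (y # xs) (xs @ [y])"
  using assms
proof (induction xs)
  case (Cons a xs)
  have "hurwitz_step G ([] @ y # a # xs) ([] @ (y \<otimes>\<^bsub>G\<^esub> a \<otimes>\<^bsub>G\<^esub> inv\<^bsub>G\<^esub> y) # y # xs)"
    unfolding hurwitz_step_iff by blast
  then have "hurwitz_step G (y # a # xs) (a # y # xs)" using Cons.prems by simp
  moreover have "(hurwitz_step G)\<^sup>*\<^sup>* (a # y # xs) (a # xs @ [y])"
    using hurwitz_steps_context[OF Cons.IH, of "[a]" "[]"] Cons.prems by simp
  ultimately show ?case by (simp add: converse_rtranclp_into_rtranclp)
qed simp

lemma gprod_DirProd: "gprod (G \<times>\<times> H) xs = (gprod G (map fst xs), gprod H (map snd xs))"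
  by (induction xs) (auto simp: mult_DirProd')

lemma (in group) gprod_one: "set xs \<subseteq> {\<one>} \<Longrightarrow> gprod G xs = \<one>"
  by (induction xs) auto

locale involution_group_pair =
  I1: involution_group G1 T1 + I2: involution_group G2 T2
  for G1 :: "'a monoid" and T1 :: "'a set" and G2 :: "'b monoid" and T2 :: "'b set"
begin

abbreviation "P \<equiv> G1 \<times>\<times> G2"
abbreviation "T \<equiv> T1 \<times> {\<one>\<^bsub>G2\<^esub>} \<union> {\<one>\<^bsub>G1\<^esub>} \<times> T2"
abbreviation "emb1 \<equiv> \<lambda>s. (s, \<one>\<^bsub>G2\<^esub>)"
abbreviation "emb2 \<equiv> \<lambda>s. (\<one>\<^bsub>G1\<^esub>, s)"

lemma group_P: "group P"
  by (intro DirProd_group I1.is_group I2.is_group)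

lemma emb_hom: "emb1 \<in> hom G1 P" "emb2 \<in> hom G2 P"
  by (auto intro!: homI)

lemma gprod_emb:
  assumes "set xs \<subseteq> carrier G1" "set ys \<subseteq> carrier G2"
  shows "gprod P (map emb1 xs @ map emb2 ys) = (gprod G1 xs, gprod G2 ys)"
proof -
  have "gprod G1 (map (\<lambda>_. \<one>\<^bsub>G1\<^esub>) ys) = \<one>\<^bsub>G1\<^esub>" by (rule I1.gprod_one) auto
  moreover have "gprod G2 (map (\<lambda>_. \<one>\<^bsub>G2\<^esub>) xs) = \<one>\<^bsub>G2\<^esub>" by (rule I2.gprod_one) auto
  ultimately show ?thesis
    using assms by (simp add: gprod_DirProd o_def I1.gprod_append I2.gprod_append image_subset_iff)
qed

sublocale P: involution_group P T
proof (intro involution_group.intro group_P involution_group_axioms.intro)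
  show "T \<subseteq> carrier P" using I1.T_carrier I2.T_carrier by auto
next
  fix t assume t: "t \<in> T"
  then show "t \<otimes>\<^bsub>P\<^esub> t = \<one>\<^bsub>P\<^esub>" using I1.T_square I2.T_square by auto
  fix g assume "g \<in> carrier P"
  then obtain g1 g2 where g: "g = (g1, g2)" "g1 \<in> carrier G1" "g2 \<in> carrier G2" by auto
  then show "g \<otimes>\<^bsub>P\<^esub> t \<otimes>\<^bsub>P\<^esub> inv\<^bsub>P\<^esub> g \<in> T"
    using t I1.T_conj[of _ g1] I2.T_conj[of _ g2]
    by (auto simp: inv_DirProd[OF I1.is_group I2.is_group])
next
  fix a assume "a \<in> carrier P"
  then obtain a1 a2 where a: "a = (a1, a2)" "a1 \<in> carrier G1" "a2 \<in> carrier G2" by auto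
  then obtain xs ys where x: "set xs \<subseteq> T1" "gprod G1 xs = a1" and y: "set ys \<subseteq> T2" "gprod G2 ys = a2"
    using I1.T_generates I2.T_generates by metis
  then have "gprod P (map emb1 xs @ map emb2 ys) = a"
    using a I1.T_carrier I2.T_carrier by (subst gprod_emb) auto
  moreover have "set (map emb1 xs @ map emb2 ys) \<subseteq> T" using x y by auto
  ultimately show "\<exists>xs. set xs \<subseteq> T \<and> gprod P xs = a" by blast
qed

definition comp1 :: "('a \<times> 'b) list \<Rightarrow> 'a list" where
  "comp1 xs = map fst (filter (\<lambda>x. x \<in> T1 \<times> {\<one>\<^bsub>G2\<^esub>}) xs)"

text \<open>Filtering by the complement counts each letter exactly once, even (1, 1), which would
  belong to both halves if 1 were in \<open>T1\<close> and in \<open>T2\<close>.\<close>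

definition comp2 :: "('a \<times> 'b) list \<Rightarrow> 'b list" where
  "comp2 xs = map snd (filter (\<lambda>x. x \<notin> T1 \<times> {\<one>\<^bsub>G2\<^esub>}) xs)"

lemma comp_T:
  assumes "set xs \<subseteq> T" shows "set (comp1 xs) \<subseteq> T1" "set (comp2 xs) \<subseteq> T2"
  using assms by (auto simp: comp1_def comp2_def)

lemma comp_length: "length (comp1 xs) + length (comp2 xs) = length xs"
  by (simp add: comp1_def comp2_def sum_length_filter_compl)

lemma comp_sort:
  assumes "set xs \<subseteq> T" shows "(hurwitz_step P)\<^sup>*\<^sup>* xs (map emb1 (comp1 xs) @ map emb2 (comp2 xs))"
  using assms
proof (induction xs)
  case Nil
  then show ?case by (simp add: comp1_def comp2_def)
next
  case (Cons x xs)
  let ?a = "map emb1 (comp1 xs)" and ?b = "map emb2 (comp2 xs)"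
  have IH: "(hurwitz_step P)\<^sup>*\<^sup>* ([x] @ xs @ []) ([x] @ (?a @ ?b) @ [])"
    using Cons by (intro hurwitz_steps_context) auto
  show ?case
  proof (cases "x \<in> T1 \<times> {\<one>\<^bsub>G2\<^esub>}")
    case True
    then show ?thesis using IH by (auto simp: comp1_def comp2_def)
  next
    case False
    then obtain y where y: "x = (\<one>\<^bsub>G1\<^esub>, y)" "y \<in> T2" using Cons.prems by auto
    have comp: "comp1 (x # xs) = comp1 xs" "comp2 (x # xs) = y # comp2 xs"
      using False y by (auto simp: comp1_def comp2_def)
    \<comment> \<open>A letter of the second factor commutes with those of the first, so the Hurwitz
      moves past them are plain transpositions.\<close>
    have "x \<otimes>\<^bsub>P\<^esub> a \<otimes>\<^bsub>P\<^esub> inv\<^bsub>P\<^esub> x = a" if "a \<in> set ?a" for a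
      using that comp_T(1)[of xs] Cons.prems y I1.T_closed I2.T_closed
      by (auto simp: inv_DirProd[OF I1.is_group I2.is_group])
    then have "(hurwitz_step P)\<^sup>*\<^sup>* (x # ?a) (?a @ [x])" by (rule hurwitz_steps_commute)
    from hurwitz_steps_context[OF this, of "[]" ?b] IH
    have "(hurwitz_step P)\<^sup>*\<^sup>* (x # xs) (?a @ [x] @ ?b)" by simp
    then show ?thesis unfolding comp using y(1) by simp
  qed
qed

lemma comp_gprod:
  assumes "set xs \<subseteq> T" shows "gprod P xs = (gprod G1 (comp1 xs), gprod G2 (comp2 xs))"
proof -
  have "gprod P xs = gprod P (map emb1 (comp1 xs) @ map emb2 (comp2 xs))"
    using P.gprod_hurwitz_steps[OF comp_sort[OF assms] subset_trans[OF assms P.T_carrier]] by simp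
  then show ?thesis using comp_T[OF assms] I1.T_carrier I2.T_carrier by (simp add: gprod_emb)
qed

lemma gen_len_P:
  assumes "a1 \<in> carrier G1" "a2 \<in> carrier G2"
  shows "gen_len P T (a1, a2) = gen_len G1 T1 a1 + gen_len G2 T2 a2"
proof (rule antisym)
  obtain xs ys where x: "xs \<in> red_words G1 T1 a1" and y: "ys \<in> red_words G2 T2 a2"
    using I1.red_words_ex[OF assms(1)] I2.red_words_ex[OF assms(2)] by metis
  have "gprod P (map emb1 xs @ map emb2 ys) = (a1, a2)"
    using x y I1.T_carrier I2.T_carrier
    by (subst gprod_emb) (auto simp: I1.red_words_iff I2.red_words_iff)
  moreover have "set (map emb1 xs @ map emb2 ys) \<subseteq> T"
    using x y by (auto simp: I1.red_words_iff I2.red_words_iff)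
  ultimately show "gen_len P T (a1, a2) \<le> gen_len G1 T1 a1 + gen_len G2 T2 a2"
    using P.gen_len_le[of "map emb1 xs @ map emb2 ys"] x y
    by (simp add: I1.red_words_iff I2.red_words_iff)
next
  obtain xs where xs: "xs \<in> red_words P T (a1, a2)"
    using P.red_words_ex[of "(a1, a2)"] assms by auto
  then have sub: "set xs \<subseteq> T" by (auto simp: P.red_words_iff)
  show "gen_len G1 T1 a1 + gen_len G2 T2 a2 \<le> gen_len P T (a1, a2)"
    using xs comp_gprod[OF sub] comp_length[of xs] I1.gen_len_le[OF comp_T(1)[OF sub]]
      I2.gen_len_le[OF comp_T(2)[OF sub]] by (auto simp: P.red_words_iff)
qed

text \<open>Each component is at least as long as the reflection length of its product, and the
  lengths add up to the minimum, so both components are reduced.\<close>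

lemma red_words_comp:
  assumes "xs \<in> red_words P T (a1, a2)"
  shows "comp1 xs \<in> red_words G1 T1 a1" "comp2 xs \<in> red_words G2 T2 a2"
proof -
  have sub: "set xs \<subseteq> T" and a: "a1 \<in> carrier G1" "a2 \<in> carrier G2"
    using assms P.red_words_closed[OF assms] by (auto simp: P.red_words_iff)
  have "gprod G1 (comp1 xs) = a1" "gprod G2 (comp2 xs) = a2"
    "length (comp1 xs) + length (comp2 xs) = gen_len G1 T1 a1 + gen_len G2 T2 a2"
    using assms comp_gprod[OF sub] comp_length[of xs] gen_len_P[OF a]
    by (auto simp: P.red_words_iff)
  then show "comp1 xs \<in> red_words G1 T1 a1" "comp2 xs \<in> red_words G2 T2 a2"
    using comp_T[OF sub] I1.gen_len_le[of "comp1 xs"] I2.gen_len_le[of "comp2 xs"]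
    by (auto simp: I1.red_words_iff I2.red_words_iff)
qed

text \<open>The equality defining the interval is the sum of two triangle inequalities, one per
  factor, so both must be equalities.\<close>

lemma interval_P:
  assumes "(a1, a2) \<in> gen_interval P T (c1, c2)" "c1 \<in> carrier G1" "c2 \<in> carrier G2"
  shows "a1 \<in> gen_interval G1 T1 c1" "a2 \<in> gen_interval G2 T2 c2"
proof -
  have a: "a1 \<in> carrier G1" "a2 \<in> carrier G2" using assms by (auto simp: P.interval_iff)
  have "gen_len G1 T1 a1 + gen_len G2 T2 a2 + (gen_len G1 T1 (inv\<^bsub>G1\<^esub> a1 \<otimes>\<^bsub>G1\<^esub> c1)
      + gen_len G2 T2 (inv\<^bsub>G2\<^esub> a2 \<otimes>\<^bsub>G2\<^esub> c2)) = gen_len G1 T1 c1 + gen_len G2 T2 c2"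
    using assms a
    by (simp add: P.interval_iff gen_len_P inv_DirProd[OF I1.is_group I2.is_group])
  moreover have "gen_len G1 T1 c1 \<le> gen_len G1 T1 a1 + gen_len G1 T1 (inv\<^bsub>G1\<^esub> a1 \<otimes>\<^bsub>G1\<^esub> c1)"
    using I1.gen_len_mult_le[of a1 "inv\<^bsub>G1\<^esub> a1 \<otimes>\<^bsub>G1\<^esub> c1"] a assms by (simp add: I1.inv_m_cancel)
  moreover have "gen_len G2 T2 c2 \<le> gen_len G2 T2 a2 + gen_len G2 T2 (inv\<^bsub>G2\<^esub> a2 \<otimes>\<^bsub>G2\<^esub> c2)"
    using I2.gen_len_mult_le[of a2 "inv\<^bsub>G2\<^esub> a2 \<otimes>\<^bsub>G2\<^esub> c2"] a assms by (simp add: I2.inv_m_cancel)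
  ultimately show "a1 \<in> gen_interval G1 T1 c1" "a2 \<in> gen_interval G2 T2 c2"
    using a by (auto simp: I1.interval_iff I2.interval_iff)
qed

lemma pan_transitive_P:
  assumes "pan_transitive G1 T1 c1" "pan_transitive G2 T2 c2" "c1 \<in> carrier G1" "c2 \<in> carrier G2"
  shows "pan_transitive P T (c1, c2)"
  unfolding P.pan_transitive_iff
proof (intro ballI)
  fix a u v assume a: "a \<in> gen_interval P T (c1, c2)"
    and u: "u \<in> red_words P T a" and v: "v \<in> red_words P T a"
  obtain a1 a2 where [simp]: "a = (a1, a2)" by (cases a)
  note int = interval_P[OF a[simplified] assms(3,4)]
  note cu = red_words_comp[OF u[simplified]] and cv = red_words_comp[OF v[simplified]]
  have uT: "set u \<subseteq> T" and vT: "set v \<subseteq> T" using u v by (auto simp: P.red_words_iff)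
  have "(hurwitz_step G1)\<^sup>*\<^sup>* (comp1 u) (comp1 v)" "(hurwitz_step G2)\<^sup>*\<^sup>* (comp2 u) (comp2 v)"
    using assms(1,2) int cu cv by (auto simp: I1.pan_transitive_iff I2.pan_transitive_iff)
  then have "(hurwitz_step P)\<^sup>*\<^sup>* (map emb1 (comp1 u)) (map emb1 (comp1 v))"
    "(hurwitz_step P)\<^sup>*\<^sup>* (map emb2 (comp2 u)) (map emb2 (comp2 v))"
    using hurwitz_steps_hom[OF I1.is_group group_P emb_hom(1)]
      hurwitz_steps_hom[OF I2.is_group group_P emb_hom(2)]
      comp_T[OF uT] I1.T_carrier I2.T_carrier by auto
  from hurwitz_steps_context[OF this(1), of "[]" "map emb2 (comp2 u)"]
    hurwitz_steps_context[OF this(2), of "map emb1 (comp1 v)" "[]"]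
  have "(hurwitz_step P)\<^sup>*\<^sup>* (map emb1 (comp1 u) @ map emb2 (comp2 u))
      (map emb1 (comp1 v) @ map emb2 (comp2 v))" by simp
  moreover have "(hurwitz_step P)\<^sup>*\<^sup>* (map emb1 (comp1 v) @ map emb2 (comp2 v)) v"
    using P.hurwitz_steps_sym[OF comp_sort[OF vT]] vT P.T_carrier by blast
  ultimately show "(hurwitz_step P)\<^sup>*\<^sup>* u v" using comp_sort[OF uT] by (meson rtranclp_trans)
qed

end

section \<open>Shuffles and stabilizers\<close>

text \<open>A braid word acts on a shuffle of a tuple over one factor with a tuple over the other by
  permuting the pattern of the shuffle and by acting on either tuple through a braid word that is
  determined by the pattern alone.\<close>

definition sum_gen :: "('a, 'c) monoid_scheme \<Rightarrow> ('b, 'd) monoid_scheme \<Rightarrow> nat \<times> bool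
    \<Rightarrow> ('a + 'b) list \<Rightarrow> ('a + 'b) list" where
  "sum_gen G1 G2 x zs = (let i = fst x in case (zs ! i, zs ! Suc i) of
       (Inl a, Inl b) \<Rightarrow>
         if snd x then zs[i := Inl b, Suc i := Inl (inv\<^bsub>G1\<^esub> b \<otimes>\<^bsub>G1\<^esub> a \<otimes>\<^bsub>G1\<^esub> b)]
         else zs[i := Inl (a \<otimes>\<^bsub>G1\<^esub> b \<otimes>\<^bsub>G1\<^esub> inv\<^bsub>G1\<^esub> a), Suc i := Inl a]
     | (Inr a, Inr b) \<Rightarrow>
         if snd x then zs[i := Inr b, Suc i := Inr (inv\<^bsub>G2\<^esub> b \<otimes>\<^bsub>G2\<^esub> a \<otimes>\<^bsub>G2\<^esub> b)]
         else zs[i := Inr (a \<otimes>\<^bsub>G2\<^esub> b \<otimes>\<^bsub>G2\<^esub> inv\<^bsub>G2\<^esub> a), Suc i := Inr a]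
     | (a, b) \<Rightarrow> zs[i := b, Suc i := a])"

definition sum_word where
  "sum_word G1 G2 w zs = foldr (sum_gen G1 G2) w zs"

text \<open>A pattern has \<open>True\<close> where the shuffle holds an entry of the first factor.
  Every braid generator, inverse or not, just transposes two positions.\<close>

definition pattern_gen :: "nat \<times> bool \<Rightarrow> bool list \<Rightarrow> bool list" where
  "pattern_gen x p = p[fst x := p ! Suc (fst x), Suc (fst x) := p ! fst x]"

definition pattern_word :: "(nat \<times> bool) list \<Rightarrow> bool list \<Rightarrow> bool list" where
  "pattern_word w p = foldr pattern_gen w p"

text \<open>A generator touches the tuple of one factor only if both of its positions belong to that
  factor. Its index there is the number of entries of that factor further left.\<close>

definition sub_letter :: "bool \<Rightarrow> bool list \<Rightarrow> nat \<times> bool \<Rightarrow> (nat \<times> bool) list" where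
  "sub_letter e p x =
     (if p ! fst x = e \<and> p ! Suc (fst x) = e then [(count_list (take (fst x) p) e, snd x)] else [])"

text \<open>Letters act from the right, so \<open>x\<close> is read against the pattern that
  \<open>w\<close> has already produced.\<close>

primrec sub_word :: "bool \<Rightarrow> bool list \<Rightarrow> (nat \<times> bool) list \<Rightarrow> (nat \<times> bool) list" where
  "sub_word e p [] = []"
| "sub_word e p (x # w) = sub_letter e (pattern_word w p) x @ sub_word e p w"

primrec lefts :: "('a + 'b) list \<Rightarrow> 'a list" where
  "lefts [] = []"
| "lefts (z # zs) = (case z of Inl a \<Rightarrow> a # lefts zs | Inr _ \<Rightarrow> lefts zs)"

primrec rights :: "('a + 'b) list \<Rightarrow> 'b list" where
  "rights [] = []"
| "rights (z # zs) = (case z of Inl _ \<Rightarrow> rights zs | Inr b \<Rightarrow> b # rights zs)"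

lemma lefts_append [simp]: "lefts (xs @ ys) = lefts xs @ lefts ys"
  by (induction xs) (auto split: sum.splits)

lemma rights_append [simp]: "rights (xs @ ys) = rights xs @ rights ys"
  by (induction xs) (auto split: sum.splits)

lemma lefts_rights_map [simp]:
  "lefts (map Inl xs) = xs" "lefts (map Inr ys) = []"
  "rights (map Inl xs) = []" "rights (map Inr ys) = ys"
  by (induction xs, auto, induction ys, auto, induction xs, auto, induction ys, auto)

lemma count_list_isl:
  "count_list (map isl zs) True = length (lefts zs)"
  "count_list (map isl zs) False = length (rights zs)"
  by (induction zs) (auto split: sum.splits)

lemma shuffle_eqI:
  "map isl xs = map isl ys \<Longrightarrow> lefts xs = lefts ys \<Longrightarrow> rights xs = rights ys \<Longrightarrow> xs = ys"
proof (induction xs arbitrary: ys)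
  case (Cons x xs)
  then obtain y ys' where ys: "ys = y # ys'" by (cases ys) auto
  show ?case using Cons.IH[of ys'] Cons.prems unfolding ys by (cases x; cases y) auto
qed simp

lemma sum_gen_split:
  "sum_gen G1 G2 (length p, e) (p @ z # z' # q) = (case (z, z') of
       (Inl a, Inl b) \<Rightarrow>
         if e then p @ Inl b # Inl (inv\<^bsub>G1\<^esub> b \<otimes>\<^bsub>G1\<^esub> a \<otimes>\<^bsub>G1\<^esub> b) # q
         else p @ Inl (a \<otimes>\<^bsub>G1\<^esub> b \<otimes>\<^bsub>G1\<^esub> inv\<^bsub>G1\<^esub> a) # Inl a # q
     | (Inr a, Inr b) \<Rightarrow>
         if e then p @ Inr b # Inr (inv\<^bsub>G2\<^esub> b \<otimes>\<^bsub>G2\<^esub> a \<otimes>\<^bsub>G2\<^esub> b) # q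
         else p @ Inr (a \<otimes>\<^bsub>G2\<^esub> b \<otimes>\<^bsub>G2\<^esub> inv\<^bsub>G2\<^esub> a) # Inr a # q
     | (a, b) \<Rightarrow> p @ b # a # q)"
  by (auto simp: sum_gen_def Let_def nth_append list_update_append split: sum.splits)

lemma pattern_gen_split:
  "length p = n \<Longrightarrow> pattern_gen (n, e) (p @ z # z' # q) = p @ z' # z # q"
  by (auto simp: pattern_gen_def nth_append list_update_append)

lemma sub_letter_split:
  "length p = n \<Longrightarrow> sub_letter d (p @ z # z' # q) (n, e)
    = (if z = d \<and> z' = d then [(count_list p d, e)] else [])"
  by (auto simp: sub_letter_def nth_append)

lemma sum_gen_components:
  assumes "fst x \<in> bgens (length zs)"
  shows "map isl (sum_gen G1 G2 x zs) = pattern_gen x (map isl zs)"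
    and "sub_letter True (map isl zs) x \<in> pwords (bgens (length (lefts zs)))"
    and "sub_letter False (map isl zs) x \<in> pwords (bgens (length (rights zs)))"
    and "lefts (sum_gen G1 G2 x zs) = hurwitz_word G1 (sub_letter True (map isl zs) x) (lefts zs)"
    and "rights (sum_gen G1 G2 x zs) = hurwitz_word G2 (sub_letter False (map isl zs) x) (rights zs)"
proof -
  have "Suc (fst x) < length zs" using assms by auto
  then obtain p z z' q where "zs = p @ z # z' # q" "length p = fst x" by (rule split_adjacent)
  then obtain e where zs: "zs = p @ z # z' # q" and x: "x = (length p, e)" by (cases x) auto
  note split = sum_gen_split pattern_gen_split sub_letter_split count_list_isl
  show "map isl (sum_gen G1 G2 x zs) = pattern_gen x (map isl zs)"
    unfolding zs x by (cases z; cases z') (auto simp: split)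
  show "sub_letter True (map isl zs) x \<in> pwords (bgens (length (lefts zs)))"
    unfolding zs x by (cases z; cases z') (auto simp: split)
  show "sub_letter False (map isl zs) x \<in> pwords (bgens (length (rights zs)))"
    unfolding zs x by (cases z; cases z') (auto simp: split)
  show "lefts (sum_gen G1 G2 x zs) = hurwitz_word G1 (sub_letter True (map isl zs) x) (lefts zs)"
    unfolding zs x by (cases z; cases z'; cases e) (auto simp: split)
  show "rights (sum_gen G1 G2 x zs) = hurwitz_word G2 (sub_letter False (map isl zs) x) (rights zs)"
    unfolding zs x by (cases z; cases z'; cases e) (auto simp: split)
qed

lemma length_sum_gen: "length (sum_gen G1 G2 x zs) = length zs"
  by (auto simp: sum_gen_def Let_def split: sum.splits)

lemma sum_word_simps [simp]:
  "sum_word G1 G2 [] zs = zs"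
  "sum_word G1 G2 (x # w) zs = sum_gen G1 G2 x (sum_word G1 G2 w zs)"
  by (auto simp: sum_word_def)

lemma length_sum_word [simp]: "length (sum_word G1 G2 w zs) = length zs"
  by (induction w) (auto simp: length_sum_gen)

lemma sum_word_components:
  assumes "w \<in> pwords (bgens (length zs))"
  shows "map isl (sum_word G1 G2 w zs) = pattern_word w (map isl zs) \<and>
    sub_word True (map isl zs) w \<in> pwords (bgens (length (lefts zs))) \<and>
    sub_word False (map isl zs) w \<in> pwords (bgens (length (rights zs))) \<and>
    lefts (sum_word G1 G2 w zs) = hurwitz_word G1 (sub_word True (map isl zs) w) (lefts zs) \<and>
    rights (sum_word G1 G2 w zs) = hurwitz_word G2 (sub_word False (map isl zs) w) (rights zs)"
  using assms
proof (induction w)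
  case Nil
  then show ?case by (simp add: pattern_word_def)
next
  case (Cons x w)
  let ?ys = "sum_word G1 G2 w zs"
  have "fst x \<in> bgens (length ?ys)" using Cons.prems by simp
  note gen = sum_gen_components(1,4,5)[OF this, of G1 G2] sum_gen_components(2,3)[OF this]
  have "length (lefts ?ys) = length (lefts zs)" "length (rights ?ys) = length (rights zs)"
    using Cons by auto
  then show ?case using gen Cons by (simp add: hurwitz_word_append pattern_word_def)
qed

text \<open>Used twice: for the coordinate embeddings into the direct product, and for the maps from
  the two Artin groups to the Artin group of the product.\<close>

locale commuting_homs =
  G1: group G1 + G2: group G2 + H: group H
  for G1 :: "('a, 'c) monoid_scheme" and G2 :: "('b, 'd) monoid_scheme"
    and H :: "('e, 'f) monoid_scheme" +
  fixes f1 f2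
  assumes f1: "f1 \<in> hom G1 H" and f2: "f2 \<in> hom G2 H"
    and commute: "x \<in> carrier G1 \<Longrightarrow> y \<in> carrier G2 \<Longrightarrow> f1 x \<otimes>\<^bsub>H\<^esub> f2 y = f2 y \<otimes>\<^bsub>H\<^esub> f1 x"
begin

abbreviation "emb \<equiv> case_sum f1 f2"

lemma sum_gen_emb:
  assumes "fst x \<in> bgens (length zs)" "set zs \<subseteq> carrier G1 <+> carrier G2"
  shows "map emb (sum_gen G1 G2 x zs) = hurwitz_gen H x (map emb zs)"
    and "set (sum_gen G1 G2 x zs) \<subseteq> carrier G1 <+> carrier G2"
proof -
  interpret h1: group_hom G1 H f1 by unfold_locales (rule f1)
  interpret h2: group_hom G2 H f2 by unfold_locales (rule f2)
  have "Suc (fst x) < length zs" using assms by auto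
  then obtain p z z' q where "zs = p @ z # z' # q" "length p = fst x" by (rule split_adjacent)
  then obtain e where zs: "zs = p @ z # z' # q" and x: "x = (length p, e)" by (cases x) auto
  have z: "z \<in> carrier G1 <+> carrier G2" "z' \<in> carrier G1 <+> carrier G2" using assms zs by auto
  have conj: "f1 a \<otimes>\<^bsub>H\<^esub> f2 b \<otimes>\<^bsub>H\<^esub> inv\<^bsub>H\<^esub> f1 a = f2 b" "inv\<^bsub>H\<^esub> f2 b \<otimes>\<^bsub>H\<^esub> f1 a \<otimes>\<^bsub>H\<^esub> f2 b = f1 a"
    "f2 b \<otimes>\<^bsub>H\<^esub> f1 a \<otimes>\<^bsub>H\<^esub> inv\<^bsub>H\<^esub> f2 b = f1 a" "inv\<^bsub>H\<^esub> f1 a \<otimes>\<^bsub>H\<^esub> f2 b \<otimes>\<^bsub>H\<^esub> f1 a = f2 b"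
    if "a \<in> carrier G1" "b \<in> carrier G2" for a b
  proof -
    have cl: "f1 a \<in> carrier H" "f2 b \<in> carrier H" using that by auto
    show "f1 a \<otimes>\<^bsub>H\<^esub> f2 b \<otimes>\<^bsub>H\<^esub> inv\<^bsub>H\<^esub> f1 a = f2 b" "inv\<^bsub>H\<^esub> f2 b \<otimes>\<^bsub>H\<^esub> f1 a \<otimes>\<^bsub>H\<^esub> f2 b = f1 a"
      using commute[OF that] cl by (simp_all add: H.m_assoc H.inv_m_cancel)
    show "f2 b \<otimes>\<^bsub>H\<^esub> f1 a \<otimes>\<^bsub>H\<^esub> inv\<^bsub>H\<^esub> f2 b = f1 a" "inv\<^bsub>H\<^esub> f1 a \<otimes>\<^bsub>H\<^esub> f2 b \<otimes>\<^bsub>H\<^esub> f1 a = f2 b"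
      using commute[OF that, symmetric] cl by (simp_all add: H.m_assoc H.inv_m_cancel)
  qed
  note hsplit = hurwitz_gen_split[of H "map emb p" "emb z" "emb z'" "map emb q"]
  show "map emb (sum_gen G1 G2 x zs) = hurwitz_gen H x (map emb zs)"
    using z hsplit unfolding zs x by (cases z; cases z'; cases e) (auto simp: sum_gen_split conj)
  show "set (sum_gen G1 G2 x zs) \<subseteq> carrier G1 <+> carrier G2"
    using z assms(2) unfolding zs x by (cases z; cases z'; cases e) (auto simp: sum_gen_split)
qed

lemma sum_word_emb:
  assumes "w \<in> pwords (bgens (length zs))" "set zs \<subseteq> carrier G1 <+> carrier G2"
  shows "map emb (sum_word G1 G2 w zs) = hurwitz_word H w (map emb zs) \<and>
    set (sum_word G1 G2 w zs) \<subseteq> carrier G1 <+> carrier G2"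
  using assms(1)
proof (induction w)
  case (Cons x w)
  then show ?case using sum_gen_emb[of x "sum_word G1 G2 w zs"] by simp
qed (use assms(2) in simp)

end

text \<open>Keeps shuffles inside the reflections. On all pairs of carriers the embedding of
  shuffles is not injective, as both identities go to (1, 1); on nontrivial reflections it is, so a
  fixed tuple in the product comes from a fixed shuffle.\<close>

lemma (in involution_group) sum_gen_T:
  assumes "involution_group G2 T2" "fst x \<in> bgens (length zs)" "set zs \<subseteq> T <+> T2"
  shows "set (sum_gen G G2 x zs) \<subseteq> T <+> T2"
proof -
  interpret I2: involution_group G2 T2 by fact
  have "Suc (fst x) < length zs" using assms by auto
  then obtain p z z' q where "zs = p @ z # z' # q" "length p = fst x" by (rule split_adjacent)
  then obtain e where zs: "zs = p @ z # z' # q" and x: "x = (length p, e)" by (cases x) auto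
  have z: "z \<in> T <+> T2" "z' \<in> T <+> T2" using assms zs by auto
  have 1: "a \<otimes> b \<otimes> inv a \<in> T" "inv b \<otimes> a \<otimes> b \<in> T" if "a \<in> T" "b \<in> T" for a b
    using that T_conj[of b a] T_conj[of a "inv b"] T_closed by auto
  have 2: "a \<otimes>\<^bsub>G2\<^esub> b \<otimes>\<^bsub>G2\<^esub> inv\<^bsub>G2\<^esub> a \<in> T2" "inv\<^bsub>G2\<^esub> b \<otimes>\<^bsub>G2\<^esub> a \<otimes>\<^bsub>G2\<^esub> b \<in> T2"
    if "a \<in> T2" "b \<in> T2" for a b
    using that I2.T_conj[of b a] I2.T_conj[of a "inv\<^bsub>G2\<^esub> b"] I2.T_closed by auto
  show ?thesis
    using z assms(3) unfolding zs x by (cases z; cases z'; cases e) (auto simp: sum_gen_split 1 2)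
qed

lemma (in involution_group) sum_word_T:
  assumes "involution_group G2 T2" "w \<in> pwords (bgens (length zs))" "set zs \<subseteq> T <+> T2"
  shows "set (sum_word G G2 w zs) \<subseteq> T <+> T2"
  using assms(2)
proof (induction w)
  case (Cons x w)
  then show ?case using sum_gen_T[OF assms(1), of x "sum_word G G2 w zs"] by simp
qed (use assms(3) in simp)

section \<open>Artin groups of the factors and of the product\<close>

lemma (in group) word_val_commute:
  assumes "f \<in> Y \<rightarrow> carrier G" "h \<in> carrier G" "\<And>y. y \<in> Y \<Longrightarrow> h \<otimes> f y = f y \<otimes> h" "w \<in> pwords Y"
  shows "h \<otimes> word_val G f w = word_val G f w \<otimes> h"
  using assms(4)
proof (induction w)
  case Nil
  then show ?case using assms(2) by simp
next
  case (Cons x w)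
  then have x: "fst x \<in> Y" and w: "w \<in> pwords Y" by auto
  have a: "f (fst x) \<in> carrier G" using x assms(1) by auto
  have "h \<otimes> inv (f (fst x)) = inv (f (fst x)) \<otimes> (f (fst x) \<otimes> h) \<otimes> inv (f (fst x))"
    using a assms(2) by (simp add: m_assoc inv_m_cancel)
  also have "\<dots> = inv (f (fst x)) \<otimes> h"
    using a assms(2) by (simp flip: assms(3)[OF x] add: m_assoc)
  finally have inv: "h \<otimes> inv (f (fst x)) = inv (f (fst x)) \<otimes> h" .
  let ?g = "if snd x then inv (f (fst x)) else f (fst x)" and ?v = "word_val G f w"
  have cl: "?g \<in> carrier G" "?v \<in> carrier G" using a word_val_closed[OF assms(1) w] by auto
  have "h \<otimes> (?g \<otimes> ?v) = (h \<otimes> ?g) \<otimes> ?v" using cl assms(2) by (simp add: m_assoc)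
  also have "h \<otimes> ?g = ?g \<otimes> h" using inv assms(3)[OF x] by simp
  also have "?g \<otimes> h \<otimes> ?v = ?g \<otimes> (h \<otimes> ?v)" using cl assms(2) by (simp add: m_assoc)
  also have "h \<otimes> ?v = ?v \<otimes> h" by (rule Cons.IH[OF w])
  also have "?g \<otimes> (?v \<otimes> h) = ?g \<otimes> ?v \<otimes> h" using cl assms(2) by (simp add: m_assoc)
  finally show ?case by simp
qed

text \<open>The other inclusion of stabilizers is automatic: the homomorphism from the Artin group
  to \<open>G\<close> carries the tuple of generators to \<open>rs\<close> and respects Hurwitz
  moves.\<close>

lemma (in involution_group) well_stabilizedI:
  assumes rs: "set rs \<subseteq> T"
    and stab: "\<And>w. w \<in> pwords (bgens (length rs)) \<Longrightarrow> hurwitz_word G w rs = rs \<Longrightarrow>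
      hurwitz_word (art_group G (set rs)) w (map (art_gen G (set rs)) rs) = map (art_gen G (set rs)) rs"
  shows "well_stabilized G rs"
proof -
  have rsc: "set rs \<subseteq> carrier G" using rs T_carrier by blast
  let ?A = "art_group G (set rs)" and ?ag = "art_gen G (set rs)"
  have A: "?A = presented_group (set rs) (art_rels G (set rs))" by (simp add: art_group_def)
  have id: "(\<lambda>s. s) \<in> set rs \<rightarrow> carrier G" using rsc by auto
  note lift = pres_lift_hom[OF is_group id art_rels_hold[OF rs]]
    pres_lift_pgen[OF is_group id art_rels_hold[OF rs]]
  let ?h = "pres_lift G (\<lambda>s. s)"
  have hg: "?h (?ag r) = r" if "r \<in> set rs" for r
    using lift(2) that by (simp add: A art_gen_def)
  have ag: "set (map ?ag rs) \<subseteq> carrier ?A" by (auto simp: A art_gen_def pgen_closed)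
  have "hurwitz_word G w rs = rs"
    if w: "w \<in> pwords (bgens (length rs))" and st: "hurwitz_word ?A w (map ?ag rs) = map ?ag rs" for w
  proof -
    have hom: "?h \<in> hom ?A G" using lift(1) by (simp add: A)
    have "group ?A" unfolding A by (rule group_presented)
    from hurwitz_word_hom[OF this is_group hom ag, of w] w st
    have "hurwitz_word G w (map ?h (map ?ag rs)) = map ?h (map ?ag rs)" by simp
    moreover have "map ?h (map ?ag rs) = rs" using hg by (simp add: map_idI)
    ultimately show ?thesis by simp
  qed
  then show ?thesis using stab by (auto simp: well_stabilized_iff[OF is_group rsc])
qed

lemma ord_inj_hom:
  assumes "group G" "group H" "h \<in> hom G H" "inj_on h (carrier G)" "x \<in> carrier G"
  shows "group.ord H (h x) = group.ord G x"
proof -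
  interpret group_hom G H h using assms by (simp add: group_hom_def group_hom_axioms_def)
  have "h x [^]\<^bsub>H\<^esub> n = \<one>\<^bsub>H\<^esub> \<longleftrightarrow> group.ord G x dvd n" for n :: nat
  proof -
    have "h x [^]\<^bsub>H\<^esub> n = h (x [^]\<^bsub>G\<^esub> n)" using assms(5) by (simp add: hom_nat_pow)
    then have "h x [^]\<^bsub>H\<^esub> n = \<one>\<^bsub>H\<^esub> \<longleftrightarrow> h (x [^]\<^bsub>G\<^esub> n) = h \<one>\<^bsub>G\<^esub>" by simp
    also have "\<dots> \<longleftrightarrow> x [^]\<^bsub>G\<^esub> n = \<one>\<^bsub>G\<^esub>" using assms(4,5) by (intro inj_on_eq_iff) auto
    finally show ?thesis using G.pow_eq_id[OF assms(5)] by simp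
  qed
  then show ?thesis using H.ord_unique[of "h x"] assms(5) by simp
qed

text \<open>The exponents in the Artin relations are orders of products, and an injective
  homomorphism preserves orders. Relations over \<open>R\<close> thus become relations over
  \<open>S\<close>.\<close>

lemma art_group_map_hom:
  assumes "group G" "group H" "e \<in> hom G H" "inj_on e (carrier G)"
    and "R \<subseteq> carrier G" "e ` R \<subseteq> S"
  defines "h \<equiv> pres_lift (art_group H S) (\<lambda>r. art_gen H S (e r))"
  shows "h \<in> hom (art_group G R) (art_group H S)" and "\<And>r. r \<in> R \<Longrightarrow> h (art_gen G R r) = art_gen H S (e r)"
proof -
  let ?A = "art_group H S" and ?f = "\<lambda>r. art_gen H S (e r)"
  have A: "?A = presented_group S (art_rels H S)" by (simp add: art_group_def)
  have grp: "group ?A" unfolding A by (rule group_presented)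
  have f: "?f \<in> R \<rightarrow> carrier ?A" using assms(6) by (auto simp: A art_gen_def pgen_closed)
  have rel: "word_val ?A ?f l = word_val ?A ?f r" if lr: "(l, r) \<in> art_rels G R" for l r
  proof -
    obtain a b where *: "l = pos_word (alt_word a b (cox_m G a b))"
      "r = pos_word (alt_word b a (cox_m G a b))" "a \<in> R" "b \<in> R" "cox_m G a b \<noteq> 0"
      using lr by (auto simp: art_rels_def)
    define n where "n = cox_m G a b"
    have ab: "a \<in> carrier G" "b \<in> carrier G" "e a \<in> S" "e b \<in> S" using * assms by auto
    have abc: "a \<otimes>\<^bsub>G\<^esub> b \<in> carrier G" using assms(1) ab by (simp add: group.is_monoid monoid.m_closed)
    then have "cox_m H (e a) (e b) = n"
      using ord_inj_hom[OF assms(1-4) abc] hom_mult[OF assms(3) ab(1,2)] by (simp add: cox_m_def n_def)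
    then have "(pos_word (alt_word (e a) (e b) n), pos_word (alt_word (e b) (e a) n)) \<in> art_rels H S"
      using ab(3,4) * unfolding art_rels_def
      by (intro CollectI exI[of _ "e a"] exI[of _ "e b"]) (simp add: n_def)
    then have "word_val ?A (art_gen H S) (pos_word (alt_word (e a) (e b) n))
        = word_val ?A (art_gen H S) (pos_word (alt_word (e b) (e a) n))"
      unfolding A art_gen_def[abs_def]
      by (rule presented_rel) (use set_alt_word ab in \<open>fastforce+\<close>)
    then show ?thesis by (simp add: * word_val_pos_word map_alt_word flip: n_def)
  qed
  show "h \<in> hom (art_group G R) (art_group H S)"
    using pres_lift_hom[OF grp f rel] by (simp add: h_def art_group_def[of G R])
  show "h (art_gen G R r) = art_gen H S (e r)" if "r \<in> R" for r
    using pres_lift_pgen[OF grp f rel that] by (simp add: h_def art_gen_def[of G R])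
qed

context involution_group_pair begin

lemma well_stabilized_P:
  assumes T: "set ss1 \<subseteq> T1" "set ss2 \<subseteq> T2" and one: "\<one>\<^bsub>G1\<^esub> \<notin> T1" "\<one>\<^bsub>G2\<^esub> \<notin> T2"
    and ws: "well_stabilized G1 ss1" "well_stabilized G2 ss2"
  shows "well_stabilized P (map emb1 ss1 @ map emb2 ss2)" (is "well_stabilized P ?rs")
proof (rule P.well_stabilizedI)
  show rsT: "set ?rs \<subseteq> T" using T by auto
  let ?A1 = "art_group G1 (set ss1)" and ?A2 = "art_group G2 (set ss2)" and ?A = "art_group P (set ?rs)"
  let ?ag1 = "art_gen G1 (set ss1)" and ?ag2 = "art_gen G2 (set ss2)" and ?ag = "art_gen P (set ?rs)"
  have c: "set ss1 \<subseteq> carrier G1" "set ss2 \<subseteq> carrier G2" using T I1.T_carrier I2.T_carrier by auto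
  define f1 where "f1 = pres_lift ?A (\<lambda>r. ?ag (emb1 r))"
  define f2 where "f2 = pres_lift ?A (\<lambda>r. ?ag (emb2 r))"
  have inj: "inj_on emb1 (carrier G1)" "inj_on emb2 (carrier G2)" by (auto simp: inj_on_def)
  have f1: "f1 \<in> hom ?A1 ?A" "\<And>r. r \<in> set ss1 \<Longrightarrow> f1 (?ag1 r) = ?ag (emb1 r)"
    unfolding f1_def by (rule art_group_map_hom[OF I1.is_group group_P emb_hom(1) inj(1) c(1)]; auto)+
  have f2: "f2 \<in> hom ?A2 ?A" "\<And>r. r \<in> set ss2 \<Longrightarrow> f2 (?ag2 r) = ?ag (emb2 r)"
    unfolding f2_def by (rule art_group_map_hom[OF I2.is_group group_P emb_hom(2) inj(2) c(2)]; auto)+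
  have grp: "group ?A1" "group ?A2" "group ?A" unfolding art_group_def by (rule group_presented)+
  interpret A: group ?A by (rule grp)
  have gens: "?ag (emb1 s) \<otimes>\<^bsub>?A\<^esub> ?ag (emb2 t) = ?ag (emb2 t) \<otimes>\<^bsub>?A\<^esub> ?ag (emb1 s)"
    if st: "s \<in> set ss1" "t \<in> set ss2" for s t
  proof -
    let ?s = "emb1 s" and ?t = "emb2 t"
    have sT: "s \<in> T1" "t \<in> T2" and R: "?s \<in> set ?rs" "?t \<in> set ?rs" using st T by auto
    have sc: "(s, t) \<in> carrier P" using sT I1.T_closed I2.T_closed by auto
    have st_eq: "?s \<otimes>\<^bsub>P\<^esub> ?t = (s, t)" using sT I1.T_closed I2.T_closed by simp
    have "(s, t) \<otimes>\<^bsub>P\<^esub> (s, t) = \<one>\<^bsub>P\<^esub>" using sT I1.T_square I2.T_square by simp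
    then have "(s, t) [^]\<^bsub>P\<^esub> (2::nat) = \<one>\<^bsub>P\<^esub>" using sc by (simp add: numeral_2_eq_2)
    then have "P.ord (s, t) dvd 2" using P.pow_eq_id[OF sc] by blast
    \<comment> \<open>Order 1 would make \<open>s\<close> and \<open>t\<close> trivial, which
      \<open>one\<close> excludes. The order is therefore 2, and the Artin relation is plain
      commutation.\<close>
    moreover have "P.ord (s, t) \<noteq> 1" using P.ord_eq_1[OF sc] sT one by auto
    ultimately have "P.ord (s, t) = 2" using prime_nat_iff two_is_prime_nat by blast
    then have m: "cox_m P ?s ?t = 2" by (simp add: cox_m_def st_eq del: mult_DirProd)
    have "(pos_word (alt_word ?s ?t (cox_m P ?s ?t)), pos_word (alt_word ?t ?s (cox_m P ?s ?t)))
        \<in> art_rels P (set ?rs)"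
      unfolding art_rels_def using R m by (intro CollectI exI[of _ ?s] exI[of _ ?t]) simp
    then have "(pos_word [?s, ?t], pos_word [?t, ?s]) \<in> art_rels P (set ?rs)"
      by (simp add: m alt_word_Suc numeral_2_eq_2)
    from presented_rel[OF this, of "set ?rs"] R
    have "word_val ?A ?ag (pos_word [?s, ?t]) = word_val ?A ?ag (pos_word [?t, ?s])"
      by (simp add: art_group_def art_gen_def[abs_def])
    moreover have "?ag ?s \<in> carrier ?A" "?ag ?t \<in> carrier ?A"
      using R by (auto simp: art_group_def art_gen_def pgen_closed)
    ultimately show ?thesis by (simp del: set_append set_map)
  qed
  have agc: "(\<lambda>r. ?ag (emb1 r)) \<in> set ss1 \<rightarrow> carrier ?A" "(\<lambda>r. ?ag (emb2 r)) \<in> set ss2 \<rightarrow> carrier ?A"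
    by (auto simp: art_group_def art_gen_def pgen_closed)
  have val: "\<exists>u\<in>pwords Y. x = word_val (presented_group Y R) (pgen Y R) u"
    if "x \<in> carrier (presented_group Y R)" for x :: "('x \<times> bool) list set" and Y R
    using that pclass_eq_word_val unfolding carrier_presented by blast
  have commute: "f1 x \<otimes>\<^bsub>?A\<^esub> f2 y = f2 y \<otimes>\<^bsub>?A\<^esub> f1 x" if xy: "x \<in> carrier ?A1" "y \<in> carrier ?A2" for x y
  proof -
    obtain u where u: "u \<in> pwords (set ss1)" "x = word_val ?A1 ?ag1 u"
      using val xy(1) unfolding art_group_def art_gen_def[abs_def] by blast
    obtain v where v: "v \<in> pwords (set ss2)" "y = word_val ?A2 ?ag2 v"
      using val xy(2) unfolding art_group_def art_gen_def[abs_def] by blast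
    have "?ag1 \<in> set ss1 \<rightarrow> carrier ?A1" "?ag2 \<in> set ss2 \<rightarrow> carrier ?A2"
      by (auto simp: art_group_def art_gen_def pgen_closed)
    then have "f1 x = word_val ?A (f1 \<circ> ?ag1) u" "f2 y = word_val ?A (f2 \<circ> ?ag2) v"
      using word_val_hom[OF grp(1,3) f1(1) _ u(1)] word_val_hom[OF grp(2,3) f2(1) _ v(1)] u v by auto
    then have eq: "f1 x = word_val ?A (\<lambda>r. ?ag (emb1 r)) u" "f2 y = word_val ?A (\<lambda>r. ?ag (emb2 r)) v"
      using word_val_cong[OF u(1), of "f1 \<circ> ?ag1" "\<lambda>r. ?ag (emb1 r)" ?A]
        word_val_cong[OF v(1), of "f2 \<circ> ?ag2" "\<lambda>r. ?ag (emb2 r)" ?A] f1(2) f2(2) by auto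
    \<comment> \<open>Commutation spreads in two stages: from generators to all of the second image,
      then from generators of the first image to all of it.\<close>
    have "?ag (emb1 s) \<otimes>\<^bsub>?A\<^esub> f2 y = f2 y \<otimes>\<^bsub>?A\<^esub> ?ag (emb1 s)" if "s \<in> set ss1" for s
      unfolding eq using gens that agc
      by (intro A.word_val_commute[OF agc(2) _ _ v(1)]) auto
    moreover have "f2 y \<in> carrier ?A" unfolding eq by (rule A.word_val_closed[OF agc(2) v(1)])
    ultimately show ?thesis
      unfolding eq(1) by (intro A.word_val_commute[OF agc(1) _ _ u(1), symmetric]) auto
  qed
  interpret EA: commuting_homs ?A1 ?A2 ?A f1 f2
    by (intro commuting_homs.intro commuting_homs_axioms.intro grp f1(1) f2(1) commute)
  interpret EP: commuting_homs G1 G2 P emb1 emb2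
    by (intro commuting_homs.intro commuting_homs_axioms.intro I1.is_group I2.is_group group_P emb_hom)
      auto
  fix w assume w: "w \<in> pwords (bgens (length ?rs))" and stab: "hurwitz_word P w ?rs = ?rs"
  let ?zs = "map Inl ss1 @ map Inr ss2" and ?p = "replicate (length ss1) True @ replicate (length ss2) False"
  have p: "map isl ?zs = ?p" by (simp add: o_def map_replicate_const)
  have wz: "w \<in> pwords (bgens (length ?zs))" using w by simp
  have zc: "set ?zs \<subseteq> carrier G1 <+> carrier G2" using c by auto
  have emb: "map EP.emb ?zs = ?rs" by simp
  have zT: "set ?zs \<subseteq> T1 <+> T2" using T by auto
  have "inj_on EP.emb (T1 <+> T2)" using one by (auto simp: inj_on_def)
  moreover have "set (sum_word G1 G2 w ?zs) \<union> set ?zs \<subseteq> T1 <+> T2"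
    using I1.sum_word_T[OF I2.involution_group_axioms wz zT] zT by (rule Un_least)
  ultimately have "inj_on EP.emb (set (sum_word G1 G2 w ?zs) \<union> set ?zs)" by (rule inj_on_subset)
  moreover have "map EP.emb (sum_word G1 G2 w ?zs) = map EP.emb ?zs"
    using conjunct1[OF EP.sum_word_emb[OF wz zc]] unfolding emb stab .
  ultimately have fixed: "sum_word G1 G2 w ?zs = ?zs" by (rule map_inj_on[rotated])
  note comp = sum_word_components[OF wz, of G1 G2, unfolded fixed p]
  have pw: "pattern_word w ?p = ?p" using comp p by simp
  have st: "sub_word True ?p w \<in> pwords (bgens (length ss1))" "sub_word False ?p w \<in> pwords (bgens (length ss2))"
    "hurwitz_word G1 (sub_word True ?p w) ss1 = ss1" "hurwitz_word G2 (sub_word False ?p w) ss2 = ss2"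
    using comp by simp_all
  have l: "hurwitz_word ?A1 (sub_word True ?p w) (map ?ag1 ss1) = map ?ag1 ss1"
    using ws(1) st(1,3) unfolding well_stabilized_iff[OF I1.is_group c(1)] by blast
  have r: "hurwitz_word ?A2 (sub_word False ?p w) (map ?ag2 ss2) = map ?ag2 ss2"
    using ws(2) st(2,4) unfolding well_stabilized_iff[OF I2.is_group c(2)] by blast
  let ?ys = "map Inl (map ?ag1 ss1) @ map Inr (map ?ag2 ss2)"
  have p': "map isl ?ys = ?p" by (simp add: o_def map_replicate_const)
  have wy: "w \<in> pwords (bgens (length ?ys))" using w by simp
  note comp' = sum_word_components[OF wy, of ?A1 ?A2, unfolded p']
  \<comment> \<open>Both shuffles start from the pattern \<open>?p\<close>, so the braid words that
    fix \<open>ss1\<close> and \<open>ss2\<close> are also the ones acting on the Artin tuples,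
    where \<open>l\<close> and \<open>r\<close> show that they act trivially.\<close>
  have "sum_word ?A1 ?A2 w ?ys = ?ys"
  proof (rule shuffle_eqI)
    show "map isl (sum_word ?A1 ?A2 w ?ys) = map isl ?ys" using comp' pw p' by (simp only:)
    show "lefts (sum_word ?A1 ?A2 w ?ys) = lefts ?ys" using comp' l by (simp del: map_map)
    show "rights (sum_word ?A1 ?A2 w ?ys) = rights ?ys" using comp' r by (simp del: map_map)
  qed
  moreover have "set ?ys \<subseteq> carrier ?A1 <+> carrier ?A2"
    by (auto simp: art_group_def art_gen_def pgen_closed)
  ultimately have "hurwitz_word ?A w (map EA.emb ?ys) = map EA.emb ?ys"
    using EA.sum_word_emb[OF wy] by simp
  moreover have "map EA.emb ?ys = map ?ag ?rs" using f1(2) f2(2) by simp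
  ultimately show "hurwitz_word ?A w (map ?ag ?rs) = map ?ag ?rs" by (simp only:)
qed

end

theorem theorem5p14:
  fixes W1 :: "'a monoid" and W2 :: "'b monoid"
    and ss1 :: "'a list" and ss2 :: "'b list"
  assumes cox1: "coxeter_system W1 (set ss1)" and dist1: "distinct ss1"
    and cox2: "coxeter_system W2 (set ss2)" and dist2: "distinct ss2"
    and ws1: "well_stabilized W1 ss1"
    and ws2: "well_stabilized W2 ss2"
    and pt1: "pan_transitive W1 (reflections W1 (set ss1)) (gprod W1 ss1)"
    and pt2: "pan_transitive W2 (reflections W2 (set ss2)) (gprod W2 ss2)"
  shows "well_stabilized (W1 \<times>\<times> W2)
           (map (\<lambda>s. (s, \<one>\<^bsub>W2\<^esub>)) ss1 @ map (\<lambda>s. (\<one>\<^bsub>W1\<^esub>, s)) ss2)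
       \<and> pan_transitive (W1 \<times>\<times> W2)
           (reflections W1 (set ss1) \<times> {\<one>\<^bsub>W2\<^esub>} \<union> {\<one>\<^bsub>W1\<^esub>} \<times> reflections W2 (set ss2))
           (gprod W1 ss1, gprod W2 ss2)
       \<and> art_group (W1 \<times>\<times> W2)
           (set (map (\<lambda>s. (s, \<one>\<^bsub>W2\<^esub>)) ss1 @ map (\<lambda>s. (\<one>\<^bsub>W1\<^esub>, s)) ss2))
         \<cong> art_star (W1 \<times>\<times> W2)
           (reflections W1 (set ss1) \<times> {\<one>\<^bsub>W2\<^esub>} \<union> {\<one>\<^bsub>W1\<^esub>} \<times> reflections W2 (set ss2))
           (gprod W1 ss1, gprod W2 ss2)"
proof -
  let ?T1 = "reflections W1 (set ss1)" and ?T2 = "reflections W2 (set ss2)"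
  interpret I: involution_group_pair W1 ?T1 W2 ?T2
    by (intro involution_group_pair.intro coxeter_involution_group cox1 cox2)
  let ?rs = "map I.emb1 ss1 @ map I.emb2 ss2"
  have T: "set ss1 \<subseteq> ?T1" "set ss2 \<subseteq> ?T2" using generators_subset_reflections cox1 cox2 by auto
  then have c: "set ss1 \<subseteq> carrier W1" "set ss2 \<subseteq> carrier W2"
    using I.I1.T_carrier I.I2.T_carrier by auto
  have one: "\<one>\<^bsub>W1\<^esub> \<notin> ?T1" "\<one>\<^bsub>W2\<^esub> \<notin> ?T2" using one_notin_reflections cox1 cox2 by auto
  have ws: "well_stabilized (W1 \<times>\<times> W2) ?rs" by (rule I.well_stabilized_P[OF T one ws1 ws2])
  have pt: "pan_transitive (W1 \<times>\<times> W2) I.T (gprod W1 ss1, gprod W2 ss2)"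
    using c by (intro I.pan_transitive_P pt1 pt2) auto
  have rs: "gprod (W1 \<times>\<times> W2) ?rs = (gprod W1 ss1, gprod W2 ss2)" by (rule I.gprod_emb[OF c])
  \<comment> \<open>Reflection length is additive on the product and known for each Coxeter element,
    so the concatenated tuple is reduced.\<close>
  have "gen_len (W1 \<times>\<times> W2) I.T (gprod W1 ss1, gprod W2 ss2) = length ?rs"
    using c coxeter_element_length[OF cox1 _ dist1] coxeter_element_length[OF cox2 _ dist2]
    by (simp add: I.gen_len_P)
  then interpret D: dual_coxeter "W1 \<times>\<times> W2" I.T ?rs
    using T one ws pt by unfold_locales (auto simp: rs)
  show ?thesis using ws pt D.art_group_iso_art_star by (simp only: rs)
qed

end
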